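(* Let $(V,h)$ be a $3$-dimensional Euclidean vector space. The map $\Psi:(S^2V^*,\diamond)\to(\mathcal{MC}(V^* ),\ast)$ defined by $\Psi(\alpha)=(\alpha-\tfrac12\operatorname{tr}(\alpha)h)\curlywedge h$ is an algebra isomorphism, where the commutative multiplication $\diamond$ on $S^2V^*$ is defined by $$\alpha\diamond\beta=\alpha\circledcirc\beta-\tfrac14\left((\operatorname{tr}\alpha)\beta+(\operatorname{tr}\beta)\alpha+\langle\alpha,\beta\rangle h-(\operatorname{tr}\alpha)(\operatorname{tr}\beta)h\right)$$ and is characterized as the unique, up to algebra isomorphism, commutative multiplication on $S^2V^*$ satisfying: (1) $O(3)=O(h)$ acts on $(S^2V^*,\diamond)$ by algebra automorphisms. (2) $(S^2V^*,\diamond)$ is metrized by an $O(3)$-invariant inner product. (3) $(S^2V^*,\diamond)$ contains no nonzero square-zero element. (4) There is an idempotent in $(S^2V^*,\diamond)$ having rank one. (5) Any idempotent in $(S^2V^*,\diamond)$ not a multiple of $h$ has rank one. (6) For a rank one idempotent $e$ in $(S^2V^*,\diamond)$, the spectrum of $L_\diamond(e)$ contains $1/2$ with multiplicity $3$. Moreover, the multiplication $\diamond$ has the following properties: (a) A nonzero idempotent in $(S^2V^*,\diamond)$ distinct from $h$ has the form $\alpha=2u\otimes u$ for a unit norm $u\in V^*$. (b) For an idempotent $\alpha$ as in (5) (that is, not a multiple of $h$, hence of rank one), the eigenvalues of $L_\diamond(\alpha)$ are $1$ with multiplicity $1$, $1/2$ with multiplicity $3$, and $-1/2$ with multiplicity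 $2$. (c) $(S^2V^*,\diamond)$ is simple. (d) For all $\alpha,\beta\in S^2V^*$, $$\tfrac{16}{3}\left(\operatorname{tr}L_\diamond(\alpha\diamond\beta)-\tfrac13\operatorname{tr}L_\diamond(\alpha)\operatorname{tr}L_\diamond(\beta)\right)=\langle\alpha,\beta\rangle=\tfrac85\left(\tau_\diamond(\alpha,\beta)+\tfrac19\operatorname{tr}L_\diamond(\alpha)\operatorname{tr}L_\diamond(\beta)\right).$$ (e) The full automorphism group of $(S^2V^*,\diamond)$ is $O(3)$ in its induced action on $S^2V^*$.
   Context: $V$ is a real vector space with positive definite symmetric bilinear form $h_{ij}$; indices are raised and lowered with $h$. Brackets around indices denote complete antisymmetrization, normalized to be a projection. For $\alpha,\beta\in S^2V^*$: $\operatorname{tr}\alpha=h^{ij}\alpha_{ij}$, $\langle\alpha,\beta\rangle=\alpha_{ij}\beta^{ij}$, $(\alpha\circledcirc\beta)_{ij}=\tfrac12(\alpha_i{}^p\beta_{pj}+\beta_i{}^p\alpha_{pj})$, and $(\alpha\curlywedge\beta)_{ijkl}=\alpha_{k[i}\beta_{j]l}-\alpha_{l[i}\beta_{j]k}$. The rank of an element of $S^2V^*$ is its rank as a bilinear form. $\mathcal{MC}(V^* )=\{Y_{ijkl}\in\otimes^4V^*: Y_{[ij]kl}=Y_{ijkl}=Y_{ij[kl]},\ Y_{[ijk]l}=0\}$. For $X\in\mathcal{MC}(V^* )$, $\widehat X\in\operatorname{End}(\otimes^kV^* )$ is $\widehat X(\alpha)_{i_1\dots i_k}=\tfrac1k\sum_{r\ne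 s}X^{p}{}_{i_ri_s}{}^{q}\,\alpha_{i_1\dots p\dots q\dots i_k}$, the sum running over ordered pairs $(r,s)$ of distinct positions, with $p$ in position $r$ and $q$ in position $s$. The commutative multiplication on $\mathcal{MC}(V^* )$ is $X\ast Y:=\widehat X(Y)$. Algebras are not assumed associative or unital. For a commutative algebra $(A,\cdot)$: $L(x)y=x\cdot y$, $\tau(x,y)=\operatorname{tr}(L(x)L(y))$; idempotent means $e\cdot e=e$; square-zero means $x\cdot x=0$; metrized by a nondegenerate symmetric bilinear form $g$ means $g(x\cdot y,z)=g(x,y\cdot z)$ for all $x,y,z$; simple means nonzero multiplication and no ideals other than $\{0\}$ and $A$.
   Formalization: In the uniqueness claim, condition (2) is read with one common O(3)-invariant inner product metrizing both ⋄ and the competing multiplication; if each may have its own, uniqueness fails (a one-parameter family of non-isomorphic multiplications satisfies (1)–(6)). *)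

theory Defs
  imports "HOL-Analysis.Analysis"
begin

section \<open>Covariant tensors on a Euclidean space\<close>

text \<open>
  The Euclidean vector space \<open>(V, h)\<close> is a type of class \<^class>\<open>euclidean_space\<close>, with
  \<open>h\<close> its inner product. Covariant tensors are (curried) multilinear maps; on a
  finite-dimensional space they are all bounded, so the library type of bounded linear maps is
  the full space of multilinear maps. Index contractions with \<open>h\<close> become sums over the
  orthonormal basis \<^const>\<open>Basis\<close>.
\<close>

type_synonym 'v covector = "'v \<Rightarrow>\<^sub>L real"
type_synonym 'v form2 = "'v \<Rightarrow>\<^sub>L 'v \<Rightarrow>\<^sub>L real"
type_synonym 'v form4 = "'v \<Rightarrow>\<^sub>L 'v \<Rightarrow>\<^sub>L 'v \<Rightarrow>\<^sub>L 'v \<Rightarrow>\<^sub>L real"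

abbreviation ap2 :: "'v::euclidean_space form2 \<Rightarrow> 'v \<Rightarrow> 'v \<Rightarrow> real" where
  "ap2 \<alpha> x y \<equiv> blinfun_apply (blinfun_apply \<alpha> x) y"

abbreviation ap4 :: "'v::euclidean_space form4 \<Rightarrow> 'v \<Rightarrow> 'v \<Rightarrow> 'v \<Rightarrow> 'v \<Rightarrow> real" where
  "ap4 Y i j k l \<equiv>
     blinfun_apply (blinfun_apply (blinfun_apply (blinfun_apply Y i) j) k) l"

text \<open>
  The tensor with prescribed values. These constructors are meaningful for multilinear arguments
  only, for which they satisfy the two lemmas below.
\<close>

definition mk2 :: "('v::euclidean_space \<Rightarrow> 'v \<Rightarrow> real) \<Rightarrow> 'v form2" where
  "mk2 f = Blinfun (\<lambda>x. Blinfun (\<lambda>y. f x y))"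

definition mk4 :: "('v::euclidean_space \<Rightarrow> 'v \<Rightarrow> 'v \<Rightarrow> 'v \<Rightarrow> real) \<Rightarrow> 'v form4" where
  "mk4 f = Blinfun (\<lambda>i. Blinfun (\<lambda>j. Blinfun (\<lambda>k. Blinfun (\<lambda>l. f i j k l))))"

lemma Blinfun_apply_linear:
  fixes f :: "'v::euclidean_space \<Rightarrow> 'w::real_normed_vector"
  assumes "linear f"
  shows "blinfun_apply (Blinfun f) = f"
  using assms by (simp add: bounded_linear_Blinfun_apply linear_conv_bounded_linear)

lemma linear_Blinfun:
  fixes f :: "'u::euclidean_space \<Rightarrow> 'v::euclidean_space \<Rightarrow> 'w::real_normed_vector"
  assumes "\<And>y. linear (\<lambda>x. f x y)" "\<And>x. linear (f x)"
  shows "linear (\<lambda>x. Blinfun (f x))"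
  using linear_add[OF assms(1)] linear_scale[OF assms(1)]
  by (intro linearI blinfun_eqI)
     (simp_all add: Blinfun_apply_linear[OF assms(2)] blinfun.bilinear_simps)

lemma mk2_apply:
  assumes "\<And>y. linear (\<lambda>x. f x y)" "\<And>x. linear (\<lambda>y. f x y)"
  shows "ap2 (mk2 f) x y = f x y"
  unfolding mk2_def using assms by (simp add: Blinfun_apply_linear linear_Blinfun)

lemma mk4_apply:
  assumes "\<And>j k l. linear (\<lambda>i. f i j k l)" "\<And>i k l. linear (\<lambda>j. f i j k l)"
    and "\<And>i j l. linear (\<lambda>k. f i j k l)" "\<And>i j k. linear (\<lambda>l. f i j k l)"
  shows "ap4 (mk4 f) i j k l = f i j k l"
proof -
  have a: "linear (\<lambda>z. Blinfun (f i j z))" for i j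
    using assms by (intro linear_Blinfun) auto
  have b: "linear (\<lambda>y. Blinfun (\<lambda>k. Blinfun (f i y k)))" for i
  proof (rule linear_Blinfun)
    show "linear (\<lambda>x. Blinfun (f i x y))" for y using assms by (intro linear_Blinfun) auto
  qed (rule a)
  have c: "linear (\<lambda>x. Blinfun (\<lambda>j. Blinfun (\<lambda>k. Blinfun (f x j k))))"
  proof (rule linear_Blinfun)
    show "linear (\<lambda>x. Blinfun (\<lambda>k. Blinfun (f x y k)))" for y
    proof (rule linear_Blinfun)
      show "linear (\<lambda>x. Blinfun (f x y z))" for z using assms by (intro linear_Blinfun) auto
    qed (rule a)
  qed (rule b)
  show ?thesis
    unfolding mk4_def using assms(4)
    by (simp add: Blinfun_apply_linear[OF a] Blinfun_apply_linear[OF b]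
        Blinfun_apply_linear[OF c] Blinfun_apply_linear)
qed


section \<open>Symmetric bilinear forms\<close>

definition sym_forms :: "'v::euclidean_space form2 set" where
  "sym_forms = {\<alpha>. \<forall>x y. ap2 \<alpha> x y = ap2 \<alpha> y x}"

definition hform :: "'v::euclidean_space form2" where
  "hform = mk2 (\<lambda>x y. x \<bullet> y)"

definition form_tr :: "'v::euclidean_space form2 \<Rightarrow> real" where
  "form_tr \<alpha> = (\<Sum>i\<in>Basis. ap2 \<alpha> i i)"

definition form_inner :: "'v::euclidean_space form2 \<Rightarrow> 'v form2 \<Rightarrow> real" where
  "form_inner \<alpha> \<beta> = (\<Sum>i\<in>Basis. \<Sum>j\<in>Basis. ap2 \<alpha> i j * ap2 \<beta> i j)"

definition form_rank :: "'v::euclidean_space form2 \<Rightarrow> nat" where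
  "form_rank \<alpha> = dim (range (blinfun_apply \<alpha>))"

definition covector_square :: "'v::euclidean_space covector \<Rightarrow> 'v form2" where
  "covector_square u = mk2 (\<lambda>x y. blinfun_apply u x * blinfun_apply u y)"

definition sym_product :: "'v::euclidean_space form2 \<Rightarrow> 'v form2 \<Rightarrow> 'v form2" where
  "sym_product \<alpha> \<beta> = mk2 (\<lambda>i j.
     (1/2) * (\<Sum>p\<in>Basis. ap2 \<alpha> i p * ap2 \<beta> p j + ap2 \<beta> i p * ap2 \<alpha> p j))"

definition diamond :: "'v::euclidean_space form2 \<Rightarrow> 'v form2 \<Rightarrow> 'v form2" where
  "diamond \<alpha> \<beta> = sym_product \<alpha> \<beta>
     - (1/4) *\<^sub>R (form_tr \<alpha> *\<^sub>R \<beta> + form_tr \<beta> *\<^sub>R \<alpha> + form_inner \<alpha> \<beta> *\<^sub>R hform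
                 - (form_tr \<alpha> * form_tr \<beta>) *\<^sub>R hform)"

text \<open>The action of an orthogonal transformation \<open>g\<close> on bilinear forms,
  \<open>(g \<cdot> \<alpha>)(x, y) = \<alpha>(g\<inverse> x, g\<inverse> y)\<close>.\<close>

definition orth_act :: "('v::euclidean_space \<Rightarrow> 'v) \<Rightarrow> 'v form2 \<Rightarrow> 'v form2" where
  "orth_act g \<alpha> = mk2 (\<lambda>x y. ap2 \<alpha> (inv g x) (inv g y))"


section \<open>Metric curvature tensors\<close>

definition curvature_tensors :: "'v::euclidean_space form4 set" where
  "curvature_tensors = {Y.
     (\<forall>i j k l. (1/2) * (ap4 Y i j k l - ap4 Y j i k l) = ap4 Y i j k l) \<and>
     (\<forall>i j k l. (1/2) * (ap4 Y i j k l - ap4 Y i j l k) = ap4 Y i j k l) \<and>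
     (\<forall>i j k l. (1/6) * (ap4 Y i j k l + ap4 Y j k i l + ap4 Y k i j l
                        - ap4 Y j i k l - ap4 Y i k j l - ap4 Y k j i l) = 0)}"

definition curly_wedge :: "'v::euclidean_space form2 \<Rightarrow> 'v form2 \<Rightarrow> 'v form4" where
  "curly_wedge \<alpha> \<beta> = mk4 (\<lambda>i j k l.
      (1/2) * (ap2 \<alpha> k i * ap2 \<beta> j l - ap2 \<alpha> k j * ap2 \<beta> i l)
    - (1/2) * (ap2 \<alpha> l i * ap2 \<beta> j k - ap2 \<alpha> l j * ap2 \<beta> i k))"

text \<open>
  The operator \<open>X\<close>-hat on \<open>k\<close>-tensors for arbitrary \<open>k\<close>: a \<open>k\<close>-tensor is given here by its
  values on argument lists of length \<open>k\<close>.
\<close>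

definition curv_hat ::
  "'v::euclidean_space form4 \<Rightarrow> ('v list \<Rightarrow> real) \<Rightarrow> 'v list \<Rightarrow> real" where
  "curv_hat X T xs = (1 / real (length xs)) *
     (\<Sum>r\<in>{..<length xs}. \<Sum>s\<in>{..<length xs} - {r}. \<Sum>p\<in>Basis. \<Sum>q\<in>Basis.
        ap4 X p (xs ! r) (xs ! s) q * T (xs[r := p, s := q]))"

definition curv_mult :: "'v::euclidean_space form4 \<Rightarrow> 'v form4 \<Rightarrow> 'v form4" where
  "curv_mult X Y = mk4 (\<lambda>i j k l.
     curv_hat X (\<lambda>xs. ap4 Y (xs ! 0) (xs ! 1) (xs ! 2) (xs ! 3)) [i, j, k, l])"

definition Psi :: "'v::euclidean_space form2 \<Rightarrow> 'v form4" where
  "Psi \<alpha> = curly_wedge (\<alpha> - (form_tr \<alpha> / 2) *\<^sub>R hform) hform"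


section \<open>Commutative algebras carried by a subspace\<close>

definition commutative_algebra :: "'a::real_vector set \<Rightarrow> ('a \<Rightarrow> 'a \<Rightarrow> 'a) \<Rightarrow> bool" where
  "commutative_algebra A m \<longleftrightarrow> subspace A \<and>
     (\<forall>x\<in>A. \<forall>y\<in>A. m x y \<in> A \<and> m x y = m y x) \<and>
     (\<forall>x\<in>A. \<forall>y\<in>A. \<forall>z\<in>A. m (x + y) z = m x z + m y z) \<and>
     (\<forall>c. \<forall>x\<in>A. \<forall>y\<in>A. m (c *\<^sub>R x) y = c *\<^sub>R m x y)"

definition algebra_isomorphism ::
  "'a::real_vector set \<Rightarrow> ('a \<Rightarrow> 'a \<Rightarrow> 'a) \<Rightarrow> 'b::real_vector set \<Rightarrow> ('b \<Rightarrow> 'b \<Rightarrow> 'b)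
     \<Rightarrow> ('a \<Rightarrow> 'b) \<Rightarrow> bool" where
  "algebra_isomorphism A m B n f \<longleftrightarrow> bij_betw f A B \<and>
     (\<forall>x\<in>A. \<forall>y\<in>A. f (x + y) = f x + f y) \<and>
     (\<forall>c. \<forall>x\<in>A. f (c *\<^sub>R x) = c *\<^sub>R f x) \<and>
     (\<forall>x\<in>A. \<forall>y\<in>A. f (m x y) = n (f x) (f y))"

definition simple_algebra :: "'a::real_vector set \<Rightarrow> ('a \<Rightarrow> 'a \<Rightarrow> 'a) \<Rightarrow> bool" where
  "simple_algebra A m \<longleftrightarrow> (\<exists>x\<in>A. \<exists>y\<in>A. m x y \<noteq> 0) \<and>
     (\<forall>I. subspace I \<and> I \<subseteq> A \<and> (\<forall>x\<in>A. \<forall>y\<in>I. m x y \<in> I \<and> m y x \<in> I)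
        \<longrightarrow> I = {0} \<or> I = A)"

definition inner_product_on :: "'a::real_vector set \<Rightarrow> ('a \<Rightarrow> 'a \<Rightarrow> real) \<Rightarrow> bool" where
  "inner_product_on A g \<longleftrightarrow>
     (\<forall>x\<in>A. \<forall>y\<in>A. g x y = g y x) \<and>
     (\<forall>x\<in>A. \<forall>y\<in>A. \<forall>z\<in>A. g (x + y) z = g x z + g y z) \<and>
     (\<forall>c. \<forall>x\<in>A. \<forall>y\<in>A. g (c *\<^sub>R x) y = c * g x y) \<and>
     (\<forall>x\<in>A. x \<noteq> 0 \<longrightarrow> g x x > 0)"

definition metrized_by ::
  "'a set \<Rightarrow> ('a \<Rightarrow> 'a \<Rightarrow> 'a) \<Rightarrow> ('a \<Rightarrow> 'a \<Rightarrow> real) \<Rightarrow> bool" where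
  "metrized_by A m g \<longleftrightarrow> (\<forall>x\<in>A. \<forall>y\<in>A. \<forall>z\<in>A. g (m x y) z = g x (m y z))"

text \<open>
  Trace, spectrum and multiplicities of an endomorphism of a finite-dimensional subspace. The
  multiplicity is the dimension of the eigenspace; it is only used for left multiplications of
  algebras metrized by an inner product, which are self-adjoint.
\<close>

definition trace_on :: "'a::real_vector set \<Rightarrow> ('a \<Rightarrow> 'a) \<Rightarrow> real" where
  "trace_on A f =
     (let B = (SOME B. independent B \<and> span B = A) in \<Sum>b\<in>B. representation B (f b) b)"

definition spectrum_on :: "'a::real_vector set \<Rightarrow> ('a \<Rightarrow> 'a) \<Rightarrow> real set" where
  "spectrum_on A f = {c. \<exists>x\<in>A. x \<noteq> 0 \<and> f x = c *\<^sub>R x}"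

definition multiplicity_on :: "'a::real_vector set \<Rightarrow> ('a \<Rightarrow> 'a) \<Rightarrow> real \<Rightarrow> nat" where
  "multiplicity_on A f c = dim {x \<in> A. f x = c *\<^sub>R x}"

definition trace_form :: "'a::real_vector set \<Rightarrow> ('a \<Rightarrow> 'a \<Rightarrow> 'a) \<Rightarrow> 'a \<Rightarrow> 'a \<Rightarrow> real" where
  "trace_form A m x y = trace_on A (\<lambda>z. m x (m y z))"


section \<open>The characterizing conditions\<close>

definition orth_invariant :: "('v::euclidean_space form2 \<Rightarrow> 'v form2 \<Rightarrow> real) \<Rightarrow> bool" where
  "orth_invariant g \<longleftrightarrow>
     (\<forall>f. orthogonal_transformation f \<longrightarrow>
        (\<forall>\<alpha>\<in>sym_forms. \<forall>\<beta>\<in>sym_forms. g (orth_act f \<alpha>) (orth_act f \<beta>) = g \<alpha> \<beta>))"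

text \<open>
  The metrizing inner product \<open>g\<close> is a parameter. Up to isomorphism, the
  multiplications satisfying the conditions below for some \<open>g\<close> form a one-parameter family of
  pairwise non-isomorphic algebras, distinguished by the ratio of \<open>g\<close> on the line of multiples
  of \<open>h\<close> to \<open>g\<close> on the trace-free forms; uniqueness holds once \<open>g\<close> is fixed.
\<close>

definition characterizing_conditions ::
  "('v::euclidean_space form2 \<Rightarrow> 'v form2 \<Rightarrow> real) \<Rightarrow> ('v form2 \<Rightarrow> 'v form2 \<Rightarrow> 'v form2) \<Rightarrow> bool"
  where
  "characterizing_conditions g m \<longleftrightarrow>
     (\<forall>f. orthogonal_transformation f \<longrightarrow>
        algebra_isomorphism sym_forms m sym_forms m (orth_act f)) \<and>
     (inner_product_on sym_forms g \<and> orth_invariant g \<and> metrized_by sym_forms m g) \<and>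
     (\<forall>\<alpha>\<in>sym_forms. m \<alpha> \<alpha> = 0 \<longrightarrow> \<alpha> = 0) \<and>
     (\<exists>e\<in>sym_forms. m e e = e \<and> form_rank e = 1) \<and>
     (\<forall>e\<in>sym_forms. m e e = e \<and> e \<notin> range (\<lambda>c. c *\<^sub>R hform) \<longrightarrow> form_rank e = 1) \<and>
     (\<forall>e\<in>sym_forms. m e e = e \<and> form_rank e = 1 \<longrightarrow>
        multiplicity_on sym_forms (m e) (1/2) = 3)"

end

theory Submission
  imports Defs
begin

text \<open>
  In an orthonormal frame diagonalizing \<open>\<alpha>\<close> one has \<open>\<alpha> \<diamond> \<alpha> = (\<alpha>\<^sup>2 + adj \<alpha>) / 2\<close>, so for the eigenvalues
  \<open>x, y, z\<close> the idempotent equations read \<open>x\<^sup>2 + y z = 2 x\<close> and cyclically; their only solutions are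
  \<open>0\<close>, \<open>h\<close> and the forms \<open>2 u \<otimes> u\<close>. Similarly, the component of \<open>\<Psi>(\<alpha>)\<close> on the planes orthogonal to
  \<open>u\<close> and \<open>v\<close> is, up to sign, \<open>\<alpha>(u, v) / 2\<close>.

  For uniqueness, equivariance under sign changes and permutations of a frame \<open>(a, b, c)\<close> forces
  \<open>m(aa, aa) = A aa + C (bb + cc)\<close> and \<open>m(aa, bb) = B (aa + bb) + D cc\<close> with constants independent of the
  frame. As \<open>g\<close> also metrizes \<open>\<diamond>\<close>, squares of orthogonal vectors are \<open>g\<close>-orthogonal, whence \<open>B = C\<close>; a rank one
  idempotent gives \<open>C = 0\<close>; and the eigenvalue \<open>1/2\<close> has multiplicity three only if \<open>A = 2 D\<close>, so that
  \<open>m = 2 A \<diamond>\<close>.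

  An automorphism \<open>f\<close> fixes \<open>h\<close>. Since \<open>h \<diamond> \<alpha> = (\<alpha> + (tr \<alpha>) h) / 4\<close>, it preserves the trace, hence also
  \<open>\<langle>\<alpha>, \<beta>\<rangle> = 4 tr (\<alpha> \<diamond> \<beta>) - tr \<alpha> tr \<beta>\<close>; therefore it maps the squares of a frame to the squares of a frame,
  and the products of distinct frame vectors to the corresponding products up to signs, which can be
  absorbed into the frame.
\<close>

section \<open>Orthonormal frames\<close>

text \<open>An orthonormal basis is carried as three vectors, with the dimension as a locale
  assumption. \<open>Basis\<close> is one such frame, but diagonalizing a form or moving by an
  isometry calls for arbitrary ones.\<close>

locale frame =
  fixes a b c :: "'v::euclidean_space"
  assumes dim3: "DIM('v) = 3"
    and unit: "a \<bullet> a = 1" "b \<bullet> b = 1" "c \<bullet> c = 1"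
    and orth: "a \<bullet> b = 0" "a \<bullet> c = 0" "b \<bullet> c = 0"
begin

lemma orth': "b \<bullet> a = 0" "c \<bullet> a = 0" "c \<bullet> b = 0"
  using orth by (simp_all add: inner_commute)

lemmas inner_frame = unit orth orth'

lemma distinct_frame: "a \<noteq> b" "a \<noteq> c" "b \<noteq> c"
  using unit orth by auto

lemma span_frame: "span {a, b, c} = UNIV"
proof -
  have "0 \<notin> {a, b, c}"
    using unit by auto
  then have "independent {a, b, c}"
    by (intro pairwise_orthogonal_independent)
       (auto simp: pairwise_def orthogonal_def inner_frame)
  moreover have "card {a, b, c} = DIM('v)"
    using distinct_frame dim3 by simp
  ultimately show ?thesis
    by (metis card_eq_dim dim_UNIV finite.emptyI finite_insert subset_UNIV top.extremum_uniqueI)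
qed

text \<open>The difference of the two sides is orthogonal to the frame, hence to its span, which is
  everything, and so to itself.\<close>

lemma expand: "x = (x \<bullet> a) *\<^sub>R a + (x \<bullet> b) *\<^sub>R b + (x \<bullet> c) *\<^sub>R c" (is "x = ?y")
proof -
  have perp: "orthogonal (x - ?y) z" if "z \<in> {a, b, c}" for z
    using that by (auto simp: orthogonal_def inner_diff_left inner_add_left inner_frame)
  have "orthogonal (x - ?y) (x - ?y)"
    by (rule orthogonal_to_span[OF _ perp]) (simp_all only: span_frame UNIV_I)
  then have "x - ?y = 0"
    by (simp only: orthogonal_self)
  then show ?thesis
    by (simp only: right_minus_eq)
qed

text \<open>Contractions are defined over \<open>Basis\<close>; this independence of the trace from
  the orthonormal basis makes them computable in any frame.\<close>

lemma sum_Basis: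
  fixes f :: "'v \<Rightarrow> 'v \<Rightarrow> real"
  assumes l: "\<And>y. linear (\<lambda>x. f x y)" and r: "\<And>x. linear (f x)"
  shows "(\<Sum>i\<in>Basis. f i i) = f a a + f b b + f c c"
proof -
  \<comment> \<open>Here the first slot of \<open>f z z\<close> is expanded over
    \<open>Basis\<close>. Below, the second slot of \<open>f i i\<close> is expanded in the frame,
    and the sum over \<open>i\<close> collapses by this identity.\<close>
  have contract: "(\<Sum>i\<in>Basis. (i \<bullet> z) * f i z) = f z z" for z
  proof -
    have "f z z = f (\<Sum>i\<in>Basis. (z \<bullet> i) *\<^sub>R i) z"
      by (simp add: euclidean_representation)
    also have "\<dots> = (\<Sum>i\<in>Basis. (i \<bullet> z) * f i z)"
      by (simp add: linear_sum[OF l] linear_scale[OF l] inner_commute)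
    finally show ?thesis ..
  qed
  have "f i i = (i \<bullet> a) * f i a + (i \<bullet> b) * f i b + (i \<bullet> c) * f i c" for i
  proof -
    have "f i i = f i ((i \<bullet> a) *\<^sub>R a + (i \<bullet> b) *\<^sub>R b + (i \<bullet> c) *\<^sub>R c)"
      by (rule arg_cong[OF expand])
    then show ?thesis
      by (simp add: linear_add[OF r] linear_scale[OF r])
  qed
  then have "(\<Sum>i\<in>Basis. f i i) =
      (\<Sum>i\<in>Basis. (i \<bullet> a) * f i a + (i \<bullet> b) * f i b + (i \<bullet> c) * f i c)"
    by (intro sum.cong) auto
  then show ?thesis
    by (simp add: sum.distrib contract)
qed

lemma inner_eq: "x \<bullet> y = (x \<bullet> a) * (y \<bullet> a) + (x \<bullet> b) * (y \<bullet> b) + (x \<bullet> c) * (y \<bullet> c)"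
proof -
  have "x \<bullet> y = ((x \<bullet> a) *\<^sub>R a + (x \<bullet> b) *\<^sub>R b + (x \<bullet> c) *\<^sub>R c) \<bullet> y"
    by (simp only: expand[symmetric])
  then show ?thesis
    by (simp add: inner_add_left inner_commute[of y])
qed

lemma swap12: "frame b a c" and swap23: "frame a c b" and rotate: "frame b c a"
  by unfold_locales (simp_all add: inner_frame dim3)

lemma scale_frame:
  assumes "s * s = 1" "t * t = 1" "u * u = 1"
  shows "frame (s *\<^sub>R a) (t *\<^sub>R b) (u *\<^sub>R c)"
  using assms by unfold_locales (simp_all add: inner_frame dim3)

lemma frame_image:
  fixes g :: "'v \<Rightarrow> 'v"
  assumes "orthogonal_transformation g"
  shows "frame (g a) (g b) (g c)"
  using assms by unfold_locales (simp_all add: orthogonal_transformation_def inner_frame dim3)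

text \<open>O(3) acts transitively on frames. Equivariance thereby becomes independence of structure
  constants from the frame, and an automorphism can be realized by the isometry between two
  frames.\<close>

lemma transformation_to_frame:
  assumes "frame a' b' c'"
  obtains g where "orthogonal_transformation g" "g a = a'" "g b = b'" "g c = c'"
proof
  interpret F': frame a' b' c' by fact
  let ?g = "\<lambda>x. (x \<bullet> a) *\<^sub>R a' + (x \<bullet> b) *\<^sub>R b' + (x \<bullet> c) *\<^sub>R c'"
  show "orthogonal_transformation ?g"
    unfolding orthogonal_transformation_def
  proof (intro conjI allI)
    show "linear ?g"
      by (simp add: linear_iff algebra_simps)
    show "?g x \<bullet> ?g y = x \<bullet> y" for x y
      by (simp add: inner_eq[of x y] inner_add_left inner_add_right F'.inner_frame)
  qed
  show "?g a = a'" "?g b = b'" "?g c = c'"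
    by (simp_all add: inner_frame)
qed

end

lemma exists_frame_Basis:
  assumes "DIM('v::euclidean_space) = 3"
  obtains a b c :: "'v::euclidean_space" where "frame a b c" "Basis = {a, b, c}"
proof -
  obtain a b c :: 'v where B: "Basis = {a, b, c}" "a \<noteq> b" "a \<noteq> c" "b \<noteq> c"
    using assms card_3_iff by metis
  then have "a \<in> Basis" "b \<in> Basis" "c \<in> Basis"
    by auto
  then have "frame a b c"
    using B assms by unfold_locales (auto simp: inner_Basis)
  with B(1) show ?thesis
    by (rule that[rotated])
qed

lemma exists_unit_orthogonal:
  fixes S :: "'v::euclidean_space set"
  assumes "finite S" "card S < DIM('v)"
  obtains x where "x \<bullet> x = 1" "\<And>y. y \<in> S \<Longrightarrow> y \<bullet> x = 0"
proof -
  have "dim S < DIM('v)"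
    using assms dim_le_card'[of S] by simp
  then obtain x where x: "x \<noteq> 0" "\<And>y. y \<in> span S \<Longrightarrow> orthogonal x y"
    using orthogonal_to_subspace_exists by blast
  show ?thesis
  proof
    show "sgn x \<bullet> sgn x = 1"
      using x(1) by (metis norm_eq_1 norm_sgn)
    show "y \<bullet> sgn x = 0" if "y \<in> S" for y
      using x(2)[OF span_base[OF that]] by (simp add: orthogonal_def sgn_div_norm inner_commute)
  qed
qed

lemma frame_of_unit:
  fixes a :: "'v::euclidean_space"
  assumes "DIM('v) = 3" "a \<bullet> a = 1"
  obtains b c where "frame a b c"
proof -
  obtain b where b: "b \<bullet> b = 1" "a \<bullet> b = 0"
    using exists_unit_orthogonal[of "{a}"] assms by auto
  have "card {a, b} < DIM('v)"
    using card_insert_le_m1[of 2 "{b}" a] assms(1) by simp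
  then obtain c where "c \<bullet> c = 1" "\<And>y. y \<in> {a, b} \<Longrightarrow> y \<bullet> c = 0"
    using exists_unit_orthogonal[of "{a, b}"] by blast
  then have "frame a b c"
    using b assms by unfold_locales auto
  then show ?thesis
    by (rule that)
qed


section \<open>Symmetric forms and their coordinates\<close>

text \<open>Vectors stand for covectors through \<open>h\<close>. For orthonormal \<open>u\<close>
  and \<open>v\<close> the form \<open>u \<odot> v\<close> has \<open>u\<close>, \<open>v\<close>
  entry 1/2 and squared norm 1/2; the factors 2 and 4 in later expansions come from this.\<close>

definition sym_tensor :: "'v::euclidean_space \<Rightarrow> 'v \<Rightarrow> 'v form2"  (infixl "\<odot>" 72) where
  "u \<odot> v = mk2 (\<lambda>x y. ((u \<bullet> x) * (v \<bullet> y) + (v \<bullet> x) * (u \<bullet> y)) / 2)"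

lemma sym_tensor_apply:
  "ap2 (u \<odot> v) x y = ((u \<bullet> x) * (v \<bullet> y) + (v \<bullet> x) * (u \<bullet> y)) / 2"
  unfolding sym_tensor_def
  by (subst mk2_apply) (simp_all add: linear_iff inner_add_right field_simps)

lemma hform_apply: "ap2 hform x y = x \<bullet> y"
  unfolding hform_def
  by (subst mk2_apply) (simp_all add: linear_iff inner_add_right inner_add_left)

lemma sym_product_apply:
  "ap2 (sym_product \<alpha> \<beta>) x y =
     (1/2) * (\<Sum>p\<in>Basis. ap2 \<alpha> x p * ap2 \<beta> p y + ap2 \<beta> x p * ap2 \<alpha> p y)"
  unfolding sym_product_def
  by (subst mk2_apply)
     (simp_all add: linear_iff blinfun.bilinear_simps algebra_simps sum.distrib sum_distrib_left
      add_divide_distrib)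

lemma orth_act_apply:
  assumes "orthogonal_transformation g"
  shows "ap2 (orth_act g \<alpha>) x y = ap2 \<alpha> (inv g x) (inv g y)"
proof -
  have "linear (inv g)"
    using assms orthogonal_transformation_inv orthogonal_transformation_linear by blast
  then show ?thesis
    unfolding orth_act_def
    by (subst mk2_apply) (simp_all add: linear_iff blinfun.bilinear_simps)
qed

text \<open>The moved form has in the moved frame the old coordinates, so an operation given by the
  same coordinate formula in all frames is equivariant.\<close>

lemma orth_act_apply_image:
  assumes "orthogonal_transformation g"
  shows "ap2 (orth_act g \<alpha>) (g x) (g y) = ap2 \<alpha> x y"
  using orthogonal_transformation_inj[OF assms] by (simp add: orth_act_apply[OF assms] inv_f_f)

lemma form2_eqI: "(\<And>x y. ap2 \<alpha> x y = ap2 \<beta> x y) \<Longrightarrow> \<alpha> = \<beta>"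
  by (intro blinfun_eqI)

lemma subspace_sym_forms: "subspace sym_forms"
  by (auto simp: subspace_def sym_forms_def blinfun.bilinear_simps)

lemma sym_formsD: "\<alpha> \<in> sym_forms \<Longrightarrow> ap2 \<alpha> x y = ap2 \<alpha> y x"
  by (auto simp: sym_forms_def)

lemma sym_tensor_in_sym_forms [simp]: "u \<odot> v \<in> sym_forms"
  by (auto simp: sym_forms_def sym_tensor_apply)

lemma hform_in_sym_forms [simp]: "hform \<in> sym_forms"
  by (auto simp: sym_forms_def hform_apply inner_commute)

lemma sym_product_in_sym_forms:
  assumes "\<alpha> \<in> sym_forms" "\<beta> \<in> sym_forms"
  shows "sym_product \<alpha> \<beta> \<in> sym_forms"
proof -
  have "(\<Sum>p\<in>Basis. ap2 \<alpha> x p * ap2 \<beta> p y + ap2 \<beta> x p * ap2 \<alpha> p y) =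
        (\<Sum>p\<in>Basis. ap2 \<alpha> y p * ap2 \<beta> p x + ap2 \<beta> y p * ap2 \<alpha> p x)" for x y
    using sym_formsD[OF assms(1)] sym_formsD[OF assms(2)] by (intro sum.cong) (auto simp: algebra_simps)
  then show ?thesis
    by (simp add: sym_forms_def sym_product_apply)
qed

lemma sym_forms_add: "\<alpha> \<in> sym_forms \<Longrightarrow> \<beta> \<in> sym_forms \<Longrightarrow> \<alpha> + \<beta> \<in> sym_forms"
  and sym_forms_diff: "\<alpha> \<in> sym_forms \<Longrightarrow> \<beta> \<in> sym_forms \<Longrightarrow> \<alpha> - \<beta> \<in> sym_forms"
  and sym_forms_scale: "\<alpha> \<in> sym_forms \<Longrightarrow> r *\<^sub>R \<alpha> \<in> sym_forms"
  by (simp_all add: subspace_sym_forms subspace_add subspace_diff subspace_scale)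

lemma sym_forms_0 [simp]: "0 \<in> sym_forms"
  using subspace_sym_forms by (rule subspace_0)

lemmas sym_forms_closed = sym_forms_add sym_forms_diff sym_forms_scale

lemma diamond_in_sym_forms:
  "\<alpha> \<in> sym_forms \<Longrightarrow> \<beta> \<in> sym_forms \<Longrightarrow> diamond \<alpha> \<beta> \<in> sym_forms"
  unfolding diamond_def by (intro sym_forms_closed sym_product_in_sym_forms hform_in_sym_forms)

lemma orth_act_in_sym_forms:
  assumes "orthogonal_transformation g" "\<alpha> \<in> sym_forms"
  shows "orth_act g \<alpha> \<in> sym_forms"
  using sym_formsD[OF assms(2)] by (simp add: sym_forms_def orth_act_apply[OF assms(1)])

lemma sym_tensor_commute: "u \<odot> v = v \<odot> u"
  by (rule form2_eqI) (simp add: sym_tensor_apply algebra_simps)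

lemma sym_tensor_scale: "(r *\<^sub>R u) \<odot> (s *\<^sub>R v) = (r * s) *\<^sub>R (u \<odot> v)"
  by (rule form2_eqI) (simp add: sym_tensor_apply blinfun.bilinear_simps algebra_simps)

lemma orth_act_sym_tensor:
  assumes "orthogonal_transformation g"
  shows "orth_act g (u \<odot> v) = g u \<odot> g v"
proof (rule form2_eqI)
  \<comment> \<open>For an orthogonal map the inverse is the adjoint.\<close>
  have "w \<bullet> inv g x = g w \<bullet> x" for w x
    using assms orthogonal_transformation_surj[OF assms]
    by (metis orthogonal_transformation_def surj_f_inv_f)
  then show "ap2 (orth_act g (u \<odot> v)) x y = ap2 (g u \<odot> g v) x y" for x y
    by (simp add: orth_act_apply[OF assms] sym_tensor_apply)
qed

lemma covector_square_eq: "covector_square (blinfun_inner_left u) = u \<odot> u"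
  by (simp add: covector_square_def sym_tensor_def inner_commute)

text \<open>The Riesz map is an isometry, the norm being attained at \<open>u\<close> itself; it
  turns unit vectors of a frame into the unit covectors of the final statement.\<close>

lemma norm_blinfun_inner_left: "norm (blinfun_inner_left u) = norm u"
proof (rule antisym)
  show "norm (blinfun_inner_left u) \<le> norm u"
    by (rule norm_blinfun_bound) (simp_all add: Cauchy_Schwarz_ineq2 mult.commute)
  have "norm u * norm u \<le> norm (blinfun_inner_left u) * norm u"
    using norm_blinfun[of "blinfun_inner_left u" u]
    by (simp add: power2_norm_eq_inner flip: power2_eq_square)
  then show "norm u \<le> norm (blinfun_inner_left u)"
    by (cases "u = 0") auto
qed

context frame
begin

lemma ap2_expand:
  "ap2 \<alpha> x y =
     (x \<bullet> a) * ((y \<bullet> a) * ap2 \<alpha> a a + (y \<bullet> b) * ap2 \<alpha> a b + (y \<bullet> c) * ap2 \<alpha> a c)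
   + (x \<bullet> b) * ((y \<bullet> a) * ap2 \<alpha> b a + (y \<bullet> b) * ap2 \<alpha> b b + (y \<bullet> c) * ap2 \<alpha> b c)
   + (x \<bullet> c) * ((y \<bullet> a) * ap2 \<alpha> c a + (y \<bullet> b) * ap2 \<alpha> c b + (y \<bullet> c) * ap2 \<alpha> c c)"
proof -
  have "ap2 \<alpha> x y = ap2 \<alpha> ((x \<bullet> a) *\<^sub>R a + (x \<bullet> b) *\<^sub>R b + (x \<bullet> c) *\<^sub>R c)
      ((y \<bullet> a) *\<^sub>R a + (y \<bullet> b) *\<^sub>R b + (y \<bullet> c) *\<^sub>R c)"
    by (simp only: expand[symmetric])
  then show ?thesis
    by (simp add: blinfun.bilinear_simps algebra_simps)
qed

lemma form_eqI:
  assumes "\<alpha> \<in> sym_forms" "\<beta> \<in> sym_forms"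
    and "ap2 \<alpha> a a = ap2 \<beta> a a" "ap2 \<alpha> b b = ap2 \<beta> b b" "ap2 \<alpha> c c = ap2 \<beta> c c"
    and "ap2 \<alpha> a b = ap2 \<beta> a b" "ap2 \<alpha> a c = ap2 \<beta> a c" "ap2 \<alpha> b c = ap2 \<beta> b c"
  shows "\<alpha> = \<beta>"
proof (rule form2_eqI)
  have "ap2 \<alpha> b a = ap2 \<beta> b a" "ap2 \<alpha> c a = ap2 \<beta> c a" "ap2 \<alpha> c b = ap2 \<beta> c b"
    using assms(3-)
    by (simp_all only: sym_formsD[OF assms(1), of b a] sym_formsD[OF assms(1), of c a] sym_formsD[OF assms(1), of c b]
        sym_formsD[OF assms(2), of b a] sym_formsD[OF assms(2), of c a] sym_formsD[OF assms(2), of c b])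
  then show "ap2 \<alpha> x y = ap2 \<beta> x y" for x y
    using assms(3-) by (simp only: ap2_expand[of \<alpha> x y] ap2_expand[of \<beta> x y])
qed

lemma form_tr_eq: "form_tr \<alpha> = ap2 \<alpha> a a + ap2 \<alpha> b b + ap2 \<alpha> c c"
  unfolding form_tr_def by (rule sum_Basis) (simp_all add: linear_iff blinfun.bilinear_simps)

lemma sym_product_eq:
  "ap2 (sym_product \<alpha> \<beta>) x y = (1/2) *
     (ap2 \<alpha> x a * ap2 \<beta> a y + ap2 \<alpha> x b * ap2 \<beta> b y + ap2 \<alpha> x c * ap2 \<beta> c y +
      ap2 \<beta> x a * ap2 \<alpha> a y + ap2 \<beta> x b * ap2 \<alpha> b y + ap2 \<beta> x c * ap2 \<alpha> c y)"
  unfolding sym_product_apply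
  by (subst sum_Basis) (simp_all add: linear_iff blinfun.bilinear_simps algebra_simps)

lemma form_inner_eq':
  "form_inner \<alpha> \<beta> =
     ap2 \<alpha> a a * ap2 \<beta> a a + ap2 \<alpha> a b * ap2 \<beta> a b + ap2 \<alpha> a c * ap2 \<beta> a c +
     ap2 \<alpha> b a * ap2 \<beta> b a + ap2 \<alpha> b b * ap2 \<beta> b b + ap2 \<alpha> b c * ap2 \<beta> b c +
     ap2 \<alpha> c a * ap2 \<beta> c a + ap2 \<alpha> c b * ap2 \<beta> c b + ap2 \<alpha> c c * ap2 \<beta> c c"
proof -
  have "(\<Sum>j\<in>Basis. ap2 \<alpha> i j * ap2 \<beta> k j) =
      ap2 \<alpha> i a * ap2 \<beta> k a + ap2 \<alpha> i b * ap2 \<beta> k b + ap2 \<alpha> i c * ap2 \<beta> k c" for i k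
    by (rule sum_Basis) (simp_all add: linear_iff blinfun.bilinear_simps algebra_simps)
  then show ?thesis
    unfolding form_inner_def
    by (simp, subst sum_Basis) (simp_all add: linear_iff blinfun.bilinear_simps algebra_simps)
qed

lemma form_inner_eq:
  assumes "\<alpha> \<in> sym_forms" "\<beta> \<in> sym_forms"
  shows "form_inner \<alpha> \<beta> =
     ap2 \<alpha> a a * ap2 \<beta> a a + ap2 \<alpha> b b * ap2 \<beta> b b + ap2 \<alpha> c c * ap2 \<beta> c c +
     2 * (ap2 \<alpha> a b * ap2 \<beta> a b + ap2 \<alpha> a c * ap2 \<beta> a c + ap2 \<alpha> b c * ap2 \<beta> b c)"
  unfolding form_inner_eq'
  using sym_formsD[OF assms(1)] sym_formsD[OF assms(2)] by (simp add: algebra_simps)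

lemma hform_coords:
  "ap2 hform a a = 1" "ap2 hform b b = 1" "ap2 hform c c = 1"
  "ap2 hform a b = 0" "ap2 hform a c = 0" "ap2 hform b c = 0"
  by (simp_all add: hform_apply inner_frame)

lemma hform_eq: "hform = a \<odot> a + b \<odot> b + c \<odot> c"
  by (rule form_eqI) (simp_all add: sym_forms_closed blinfun.bilinear_simps sym_tensor_apply hform_apply inner_frame)

text \<open>Cayley-Hamilton for 3 by 3 matrices gives adj \<alpha> = \<alpha>^2 - (tr \<alpha>)
  \<alpha> + ((tr \<alpha>)^2 - |\<alpha>|^2)/2 h, so the trace terms of \<open>diamond\<close>
  assemble into cofactors: the entries are half those of the polarized square plus the polarized
  adjugate.\<close>

lemma diamond_coords:
  assumes "\<alpha> \<in> sym_forms" "\<beta> \<in> sym_forms"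
  shows
    "ap2 (diamond \<alpha> \<beta>) a a =
       (ap2 \<alpha> a a * ap2 \<beta> a a + ap2 \<alpha> a b * ap2 \<beta> a b + ap2 \<alpha> a c * ap2 \<beta> a c) / 2
       + (ap2 \<alpha> b b * ap2 \<beta> c c + ap2 \<alpha> c c * ap2 \<beta> b b) / 4 - ap2 \<alpha> b c * ap2 \<beta> b c / 2"
    "ap2 (diamond \<alpha> \<beta>) b b =
       (ap2 \<alpha> b b * ap2 \<beta> b b + ap2 \<alpha> a b * ap2 \<beta> a b + ap2 \<alpha> b c * ap2 \<beta> b c) / 2
       + (ap2 \<alpha> a a * ap2 \<beta> c c + ap2 \<alpha> c c * ap2 \<beta> a a) / 4 - ap2 \<alpha> a c * ap2 \<beta> a c / 2"
    "ap2 (diamond \<alpha> \<beta>) c c =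
       (ap2 \<alpha> c c * ap2 \<beta> c c + ap2 \<alpha> a c * ap2 \<beta> a c + ap2 \<alpha> b c * ap2 \<beta> b c) / 2
       + (ap2 \<alpha> a a * ap2 \<beta> b b + ap2 \<alpha> b b * ap2 \<beta> a a) / 4 - ap2 \<alpha> a b * ap2 \<beta> a b / 2"
    "ap2 (diamond \<alpha> \<beta>) a b =
       (ap2 \<alpha> a b * (ap2 \<beta> a a + ap2 \<beta> b b - ap2 \<beta> c c)
       + ap2 \<beta> a b * (ap2 \<alpha> a a + ap2 \<alpha> b b - ap2 \<alpha> c c)) / 4
       + (ap2 \<alpha> a c * ap2 \<beta> b c + ap2 \<alpha> b c * ap2 \<beta> a c) / 2"
    "ap2 (diamond \<alpha> \<beta>) a c =
       (ap2 \<alpha> a c * (ap2 \<beta> a a + ap2 \<beta> c c - ap2 \<beta> b b)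
       + ap2 \<beta> a c * (ap2 \<alpha> a a + ap2 \<alpha> c c - ap2 \<alpha> b b)) / 4
       + (ap2 \<alpha> a b * ap2 \<beta> b c + ap2 \<alpha> b c * ap2 \<beta> a b) / 2"
    "ap2 (diamond \<alpha> \<beta>) b c =
       (ap2 \<alpha> b c * (ap2 \<beta> b b + ap2 \<beta> c c - ap2 \<beta> a a)
       + ap2 \<beta> b c * (ap2 \<alpha> b b + ap2 \<alpha> c c - ap2 \<alpha> a a)) / 4
       + (ap2 \<alpha> a b * ap2 \<beta> a c + ap2 \<alpha> a c * ap2 \<beta> a b) / 2"
  by (simp_all add: diamond_def blinfun.bilinear_simps sym_product_eq form_tr_eq
      form_inner_eq[OF assms] hform_coords
      sym_formsD[OF assms(1), of b a] sym_formsD[OF assms(1), of c a] sym_formsD[OF assms(1), of c b]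
      sym_formsD[OF assms(2), of b a] sym_formsD[OF assms(2), of c a] sym_formsD[OF assms(2), of c b]
      field_simps)

end

section \<open>Diagonalization\<close>

text \<open>Maximum of the Rayleigh quotient by compactness, extended from the unit sphere by
  homogeneity. It is relative to a subspace so that it can be repeated on the complement of the
  first maximizer.\<close>

lemma form_max_on_sphere:
  fixes \<alpha> :: "'v::euclidean_space form2"
  assumes S: "subspace S" and ne: "z \<in> S" "z \<bullet> z = 1"
  obtains u where "u \<in> S" "u \<bullet> u = 1" "\<And>x. x \<in> S \<Longrightarrow> ap2 \<alpha> x x \<le> ap2 \<alpha> u u * (x \<bullet> x)"
proof -
  have "compact (sphere 0 1 \<inter> S)"
    using closed_subspace[OF S] by (simp add: compact_Int_closed)
  moreover have "z \<in> sphere 0 1 \<inter> S"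
    using ne by (simp add: norm_eq_1)
  moreover have "continuous_on (sphere 0 1 \<inter> S) (\<lambda>x. ap2 \<alpha> x x)"
    by (intro continuous_intros)
  ultimately obtain u where "u \<in> sphere 0 1 \<inter> S"
    and "\<And>x. x \<in> sphere 0 1 \<inter> S \<Longrightarrow> ap2 \<alpha> x x \<le> ap2 \<alpha> u u"
    using continuous_attains_sup[of "sphere 0 1 \<inter> S" "\<lambda>x. ap2 \<alpha> x x"] by blast
  then have u: "u \<in> S" "norm u = 1"
    and max: "\<And>x. x \<in> S \<Longrightarrow> norm x = 1 \<Longrightarrow> ap2 \<alpha> x x \<le> ap2 \<alpha> u u"
    by auto
  have "ap2 \<alpha> x x \<le> ap2 \<alpha> u u * (x \<bullet> x)" if "x \<in> S" for x
  proof (cases "x = 0")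
    case False
    define y where "y = sgn x"
    have y: "y \<in> S" "norm y = 1" "x = norm x *\<^sub>R y"
      using False that by (auto simp: y_def sgn_div_norm norm_sgn intro: subspace_scale[OF S])
    have "ap2 \<alpha> x x = (norm x)\<^sup>2 * ap2 \<alpha> y y"
      by (subst (1 2) y(3)) (simp add: blinfun.bilinear_simps power2_eq_square)
    also have "\<dots> \<le> (norm x)\<^sup>2 * ap2 \<alpha> u u"
      using max[OF y(1,2)] by (intro mult_left_mono) auto
    finally show ?thesis
      by (simp add: power2_norm_eq_inner mult.commute)
  qed (simp add: blinfun.bilinear_simps)
  with u show ?thesis
    by (intro that[of u]) (auto simp: norm_eq_1)
qed

lemma linear_le_quadratic_imp_zero:
  fixes k K :: real
  assumes "\<And>t. 2 * t * k \<le> t\<^sup>2 * K"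
  shows "k = 0"
proof (rule ccontr)
  assume "k \<noteq> 0"
  define M where "M = \<bar>K\<bar> + 1"
  have M: "M > 0" "K < M"
    by (auto simp: M_def)
  \<comment> \<open>With t = k / M the left side is 2 k^2 / M, while K < M keeps the right side
    below k^2 / M.\<close>
  have "2 * (k / M) * k \<le> (k / M)\<^sup>2 * K"
    by (rule assms)
  then have "2 * k\<^sup>2 * M \<le> k\<^sup>2 * K"
    using M by (simp add: field_simps power2_eq_square)
  then have "2 * M \<le> K"
    using \<open>k \<noteq> 0\<close> by (simp add: mult.assoc mult.left_commute[of _ "k\<^sup>2"])
  with M show False
    by linarith
qed

text \<open>First-order condition: when the maximum is tested on \<open>u + t *\<^sub>R y\<close>,
  the terms free of \<open>t\<close> cancel, and the linear term stays below a quadratic one for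
  every \<open>t\<close>.\<close>

lemma critical_point_orthogonal:
  fixes \<alpha> :: "'v::euclidean_space form2"
  assumes "\<alpha> \<in> sym_forms" "subspace S" "u \<in> S" "u \<bullet> u = 1"
    and max: "\<And>x. x \<in> S \<Longrightarrow> ap2 \<alpha> x x \<le> ap2 \<alpha> u u * (x \<bullet> x)"
    and y: "y \<in> S" "u \<bullet> y = 0"
  shows "ap2 \<alpha> u y = 0"
proof (rule linear_le_quadratic_imp_zero)
  fix t
  have "u + t *\<^sub>R y \<in> S"
    using assms by (intro subspace_add subspace_scale)
  from max[OF this] show "2 * t * ap2 \<alpha> u y \<le> t\<^sup>2 * (ap2 \<alpha> u u * (y \<bullet> y) - ap2 \<alpha> y y)"
    using assms(4) y(2) sym_formsD[OF assms(1), of y u]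
    by (simp add: blinfun.bilinear_simps inner_add_left inner_add_right inner_commute[of y u]
        power2_eq_square algebra_simps)
qed

text \<open>Maximize on all of V, then on the complement of \<open>a\<close>. Any unit vector
  orthogonal to both completes the frame, since the two first-order conditions already kill the
  three mixed entries.\<close>

lemma diagonalization:
  fixes \<alpha> :: "'v::euclidean_space form2"
  assumes "DIM('v) = 3" "\<alpha> \<in> sym_forms"
  obtains a b c where "frame a b c" "ap2 \<alpha> a b = 0" "ap2 \<alpha> a c = 0" "ap2 \<alpha> b c = 0"
proof -
  obtain z :: 'v where "z \<bullet> z = 1"
    using exists_unit_orthogonal[of "{}"] assms(1) by auto
  then obtain a where a: "a \<bullet> a = 1" "\<And>x. ap2 \<alpha> x x \<le> ap2 \<alpha> a a * (x \<bullet> x)"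
    using form_max_on_sphere[of UNIV z \<alpha>] by auto
  have a0: "ap2 \<alpha> a y = 0" if "a \<bullet> y = 0" for y
    using assms a that by (intro critical_point_orthogonal[of \<alpha> UNIV]) auto
  define S where "S = {x. a \<bullet> x = 0}"
  have S: "subspace S"
    by (simp add: S_def subspace_hyperplane)
  obtain z where z: "z \<in> S" "z \<bullet> z = 1"
    using exists_unit_orthogonal[of "{a}"] assms(1) by (auto simp: S_def)
  obtain b where b: "b \<in> S" "b \<bullet> b = 1" "\<And>x. x \<in> S \<Longrightarrow> ap2 \<alpha> x x \<le> ap2 \<alpha> b b * (x \<bullet> x)"
    using form_max_on_sphere[OF S z, of \<alpha>] by auto
  have b0: "ap2 \<alpha> b y = 0" if "a \<bullet> y = 0" "b \<bullet> y = 0" for y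
    using assms b that S by (intro critical_point_orthogonal[of \<alpha> S]) (auto simp: S_def)
  have "card {a, b} < DIM('v)"
    using card_insert_le_m1[of 2 "{b}" a] assms(1) by simp
  then obtain c where c: "c \<bullet> c = 1" "\<And>y. y \<in> {a, b} \<Longrightarrow> y \<bullet> c = 0"
    using exists_unit_orthogonal[of "{a, b}"] by blast
  have "frame a b c"
    using a b c assms(1) by unfold_locales (auto simp: S_def)
  then show ?thesis
    using a0 b0 b c by (intro that) (auto simp: S_def)
qed

lemma (in frame) sym_form_eq:
  assumes "\<alpha> \<in> sym_forms"
  shows "\<alpha> = ap2 \<alpha> a a *\<^sub>R (a \<odot> a) + ap2 \<alpha> b b *\<^sub>R (b \<odot> b) + ap2 \<alpha> c c *\<^sub>R (c \<odot> c)
    + (2 * ap2 \<alpha> a b) *\<^sub>R (a \<odot> b) + (2 * ap2 \<alpha> a c) *\<^sub>R (a \<odot> c) + (2 * ap2 \<alpha> b c) *\<^sub>R (b \<odot> c)"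
  by (rule form_eqI)
     (simp_all add: assms sym_forms_closed blinfun.bilinear_simps sym_tensor_apply inner_frame)

lemma diagonal_form:
  fixes \<alpha> :: "'v::euclidean_space form2"
  assumes "DIM('v) = 3" "\<alpha> \<in> sym_forms"
  obtains a b c x y z where "frame a b c" "\<alpha> = x *\<^sub>R (a \<odot> a) + y *\<^sub>R (b \<odot> b) + z *\<^sub>R (c \<odot> c)"
proof -
  obtain a b c where f: "frame a b c" and "ap2 \<alpha> a b = 0" "ap2 \<alpha> a c = 0" "ap2 \<alpha> b c = 0"
    using diagonalization[OF assms] .
  then have "\<alpha> = ap2 \<alpha> a a *\<^sub>R (a \<odot> a) + ap2 \<alpha> b b *\<^sub>R (b \<odot> b) + ap2 \<alpha> c c *\<^sub>R (c \<odot> c)"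
    using frame.sym_form_eq[OF f assms(2)] by simp
  with f show ?thesis
    by (rule that)
qed


section \<open>Rank one\<close>

lemma form_rank_square:
  assumes "u \<noteq> 0" "r \<noteq> 0"
  shows "form_rank (r *\<^sub>R (u \<odot> u)) = 1"
proof -
  let ?w = "blinfun_inner_left u"
  have app: "blinfun_apply (r *\<^sub>R (u \<odot> u)) x = (r * (u \<bullet> x)) *\<^sub>R ?w" for x
    by (rule blinfun_eqI) (simp add: blinfun.bilinear_simps sym_tensor_apply inner_commute)
  \<comment> \<open>Every multiple of the covector dual to \<open>u\<close> is attained, by solving
    along the direction of \<open>u\<close>.\<close>
  have "t *\<^sub>R ?w = blinfun_apply (r *\<^sub>R (u \<odot> u)) ((t / (r * (u \<bullet> u))) *\<^sub>R u)" for t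
    unfolding app using assms by simp
  then have "range (\<lambda>t. t *\<^sub>R ?w) \<subseteq> range (blinfun_apply (r *\<^sub>R (u \<odot> u)))"
    by blast
  then have "range (blinfun_apply (r *\<^sub>R (u \<odot> u))) = span {?w}"
    by (auto simp: span_singleton app)
  moreover have "?w \<noteq> 0"
    using assms(1) by (metis norm_blinfun_inner_left norm_eq_zero)
  ultimately show ?thesis
    using dim_span_eq_card_independent[of "{?w}"] by (simp add: form_rank_def)
qed

lemma form_rank_one_span:
  assumes "form_rank \<alpha> = 1"
  obtains w where "\<And>x. \<exists>r. blinfun_apply \<alpha> x = r *\<^sub>R w"
proof -
  obtain B where "range (blinfun_apply \<alpha>) \<subseteq> span B" "card B = 1"
    using basis_exists[of "range (blinfun_apply \<alpha>)"] assms unfolding form_rank_def by metis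
  then obtain w where "range (blinfun_apply \<alpha>) \<subseteq> span {w}"
    by (auto simp: card_1_singleton_iff)
  then show ?thesis
    by (intro that) (auto simp: span_singleton)
qed

text \<open>The covectors \<alpha>(a, .) = r w and \<alpha>(b, .) = s w are multiples of one w, and
  r w(b) = 0. Either r = 0 and the first entry vanishes, or w(b) = 0 and the second does.\<close>

lemma (in frame) form_rank_one_diagonal:
  assumes "form_rank \<alpha> = 1" "ap2 \<alpha> a b = 0"
  shows "ap2 \<alpha> a a = 0 \<or> ap2 \<alpha> b b = 0"
proof -
  obtain w where w: "\<And>x. \<exists>r. blinfun_apply \<alpha> x = r *\<^sub>R w"
    using form_rank_one_span[OF assms(1)] by blast
  obtain r s where "blinfun_apply \<alpha> a = r *\<^sub>R w" "blinfun_apply \<alpha> b = s *\<^sub>R w"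
    using w[of a] w[of b] by blast
  with assms(2) show ?thesis
    by (auto simp: blinfun.bilinear_simps)
qed

lemma form_rank_zero: "form_rank (0 :: 'a::euclidean_space form2) = 0"
  using dim_eq_card[of "{}" "{0 :: 'a covector}"] independent_empty
  by (simp add: form_rank_def image_constant_conv)

text \<open>In a diagonalizing frame the preceding alternative, taken for each pair of axes, leaves
  a single nonzero diagonal entry; a cyclic rotation puts it first.\<close>

lemma form_rank_oneE:
  fixes \<alpha> :: "'v::euclidean_space form2"
  assumes "DIM('v) = 3" "\<alpha> \<in> sym_forms" "form_rank \<alpha> = 1"
  obtains a b c r where "frame a b c" "r \<noteq> 0" "\<alpha> = r *\<^sub>R (a \<odot> a)"
proof -
  obtain a b c where f: "frame a b c" and off: "ap2 \<alpha> a b = 0" "ap2 \<alpha> a c = 0" "ap2 \<alpha> b c = 0"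
    using diagonalization[OF assms(1,2)] .
  interpret frame a b c by fact
  note eq = sym_form_eq[OF assms(2), unfolded off, simplified]
  have "ap2 \<alpha> a a = 0 \<or> ap2 \<alpha> b b = 0" "ap2 \<alpha> a a = 0 \<or> ap2 \<alpha> c c = 0" "ap2 \<alpha> b b = 0 \<or> ap2 \<alpha> c c = 0"
    using form_rank_one_diagonal[OF assms(3)] frame.form_rank_one_diagonal[OF swap23 assms(3)]
      frame.form_rank_one_diagonal[OF rotate assms(3)] off by auto
  moreover have "\<alpha> \<noteq> 0"
    using assms(3) form_rank_zero[where 'a = 'v] by auto
  ultimately consider "ap2 \<alpha> a a \<noteq> 0" "ap2 \<alpha> b b = 0" "ap2 \<alpha> c c = 0"
    | "ap2 \<alpha> b b \<noteq> 0" "ap2 \<alpha> a a = 0" "ap2 \<alpha> c c = 0"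
    | "ap2 \<alpha> c c \<noteq> 0" "ap2 \<alpha> a a = 0" "ap2 \<alpha> b b = 0"
    using eq by fastforce
  then show ?thesis
  proof cases
    case 1
    with eq f show ?thesis by (intro that[of a b c "ap2 \<alpha> a a"]) auto
  next
    case 2
    with eq rotate show ?thesis by (intro that[of b c a "ap2 \<alpha> b b"]) auto
  next
    case 3
    with eq frame.rotate[OF rotate] show ?thesis by (intro that[of c a b "ap2 \<alpha> c c"]) auto
  qed
qed

text \<open>This places the rank one idempotents of condition (6) outside the line of
  \<open>hform\<close>, where the classification of idempotents describes them.\<close>

lemma form_rank_hform_multiple:
  assumes "DIM('v::euclidean_space) = 3"
  shows "form_rank (r *\<^sub>R (hform :: 'v form2)) \<noteq> 1"
proof
  assume rank: "form_rank (r *\<^sub>R (hform :: 'v form2)) = 1"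
  obtain a b c :: 'v where "frame a b c"
    using exists_frame_Basis[OF assms] .
  then interpret frame a b c .
  have "r = 0"
    using form_rank_one_diagonal[OF rank] by (simp add: blinfun.bilinear_simps hform_coords)
  with rank show False
    by (simp add: form_rank_zero)
qed


section \<open>The algebra of symmetric forms in dimension three\<close>

lemma form_tr_add: "form_tr (\<alpha> + \<beta>) = form_tr \<alpha> + form_tr \<beta>"
  and form_tr_scale: "form_tr (r *\<^sub>R \<alpha>) = r * form_tr \<alpha>"
  by (simp_all add: form_tr_def blinfun.bilinear_simps sum.distrib sum_distrib_left)

lemma form_inner_add: "form_inner (\<alpha> + \<beta>) \<gamma> = form_inner \<alpha> \<gamma> + form_inner \<beta> \<gamma>"
  and form_inner_scale: "form_inner (r *\<^sub>R \<alpha>) \<gamma> = r * form_inner \<alpha> \<gamma>"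
  by (simp_all add: form_inner_def blinfun.bilinear_simps sum.distrib sum_distrib_left algebra_simps)

lemma form_inner_commute: "form_inner \<alpha> \<beta> = form_inner \<beta> \<alpha>"
  by (simp add: form_inner_def mult.commute)

lemma sym_product_commute: "sym_product \<alpha> \<beta> = sym_product \<beta> \<alpha>"
  by (simp add: sym_product_def add.commute)

lemma sym_product_add: "sym_product (\<alpha> + \<beta>) \<gamma> = sym_product \<alpha> \<gamma> + sym_product \<beta> \<gamma>"
  by (rule form2_eqI)
     (simp add: sym_product_apply blinfun.bilinear_simps sum.distrib algebra_simps add_divide_distrib)

lemma sym_product_scale: "sym_product (r *\<^sub>R \<alpha>) \<gamma> = r *\<^sub>R sym_product \<alpha> \<gamma>"
  by (rule form2_eqI)
     (simp add: sym_product_apply blinfun.bilinear_simps sum_distrib_left algebra_simps)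

lemma diamond_commute: "diamond \<alpha> \<beta> = diamond \<beta> \<alpha>"
  unfolding diamond_def sym_product_commute[of \<alpha>] form_inner_commute[of \<alpha>]
  by (simp add: algebra_simps)

lemma diamond_add: "diamond (\<alpha> + \<beta>) \<gamma> = diamond \<alpha> \<gamma> + diamond \<beta> \<gamma>"
  unfolding diamond_def sym_product_add form_inner_add form_tr_add by (simp add: algebra_simps)

lemma diamond_scale: "diamond (r *\<^sub>R \<alpha>) \<gamma> = r *\<^sub>R diamond \<alpha> \<gamma>"
  unfolding diamond_def sym_product_scale form_inner_scale form_tr_scale
  by (simp add: algebra_simps)

lemma linear_diamond: "linear (diamond \<alpha>)"
  by (simp add: linear_iff diamond_commute[of \<alpha>] diamond_add diamond_scale)

lemma commutative_algebra_diamond: "commutative_algebra sym_forms diamond"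
  by (auto simp: commutative_algebra_def subspace_sym_forms diamond_in_sym_forms diamond_add
      diamond_scale intro: diamond_commute)

lemma orth_act_linear: "linear (orth_act g)" if "orthogonal_transformation g"
  by (auto simp: linear_iff orth_act_apply[OF that] blinfun.bilinear_simps intro!: form2_eqI)

lemma orth_act_inverse:
  assumes "orthogonal_transformation g"
  shows "orth_act (inv g) (orth_act g \<alpha>) = \<alpha>" "orth_act g (orth_act (inv g) \<alpha>) = \<alpha>"
  using assms orthogonal_transformation_bij[OF assms]
  by (auto intro!: form2_eqI
      simp: orth_act_apply orthogonal_transformation_inv inv_inv_eq bij_is_inj bij_is_surj surj_f_inv_f inv_f_f)

text \<open>The coordinate formula for \<open>diamond\<close> is the same in the frame
  \<open>a\<close>, \<open>b\<close>, \<open>c\<close> and in the frame \<open>g a\<close>,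
  \<open>g b\<close>, \<open>g c\<close>.\<close>

lemma orth_act_diamond:
  fixes g :: "'v::euclidean_space \<Rightarrow> 'v"
  assumes "DIM('v) = 3" "orthogonal_transformation g" "\<alpha> \<in> sym_forms" "\<beta> \<in> sym_forms"
  shows "orth_act g (diamond \<alpha> \<beta>) = diamond (orth_act g \<alpha>) (orth_act g \<beta>)"
proof -
  obtain a b c :: 'v where "frame a b c"
    using exists_frame_Basis[OF assms(1)] .
  then interpret frame a b c .
  interpret G: frame "g a" "g b" "g c"
    by (rule frame_image) fact
  note closed = diamond_in_sym_forms orth_act_in_sym_forms[OF assms(2)] assms(3,4)
  show ?thesis
    by (rule G.form_eqI)
       (simp_all only: closed orth_act_apply_image[OF assms(2)] diamond_coords G.diamond_coords)
qed

lemma algebra_isomorphism_orth_act: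
  fixes g :: "'v::euclidean_space \<Rightarrow> 'v"
  assumes "DIM('v) = 3" "orthogonal_transformation g"
  shows "algebra_isomorphism sym_forms diamond sym_forms diamond (orth_act g)"
proof -
  have "orthogonal_transformation (inv g)"
    using assms(2) by (rule orthogonal_transformation_inv)
  then have "bij_betw (orth_act g) sym_forms sym_forms"
    using assms(2) orth_act_inverse[OF assms(2)]
    by (intro bij_betw_byWitness[where f' = "orth_act (inv g)"]) (auto intro: orth_act_in_sym_forms)
  then show ?thesis
    using orth_act_linear[OF assms(2)] orth_act_diamond[OF assms]
    by (auto simp: algebra_isomorphism_def linear_add linear_scale)
qed

lemma form_inner_orth_act:
  fixes g :: "'v::euclidean_space \<Rightarrow> 'v"
  assumes "DIM('v) = 3" "orthogonal_transformation g"
  shows "form_inner (orth_act g \<alpha>) (orth_act g \<beta>) = form_inner \<alpha> \<beta>"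
proof -
  obtain a b c :: 'v where "frame a b c"
    using exists_frame_Basis[OF assms(1)] .
  then interpret frame a b c .
  interpret G: frame "g a" "g b" "g c"
    by (rule frame_image) fact
  show ?thesis
    by (simp only: form_inner_eq'[of \<alpha>] G.form_inner_eq'[of "orth_act g \<alpha>"] orth_act_apply_image[OF assms(2)])
qed

lemma inner_product_form_inner:
  assumes "DIM('v::euclidean_space) = 3"
  shows "inner_product_on (sym_forms :: 'v form2 set) form_inner"
proof -
  obtain a b c :: 'v where "frame a b c"
    using exists_frame_Basis[OF assms] .
  then interpret frame a b c .
  have "form_inner \<alpha> \<alpha> > 0" if "\<alpha> \<in> sym_forms" "\<alpha> \<noteq> 0" for \<alpha> :: "'v form2"
  proof -
    have "form_inner \<alpha> \<alpha> \<ge> 0"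
      by (simp add: form_inner_eq')
    moreover have "form_inner \<alpha> \<alpha> \<noteq> 0"
    proof
      assume "form_inner \<alpha> \<alpha> = 0"
      then have "(ap2 \<alpha> a a)\<^sup>2 + (ap2 \<alpha> b b)\<^sup>2 + (ap2 \<alpha> c c)\<^sup>2
          + 2 * ((ap2 \<alpha> a b)\<^sup>2 + (ap2 \<alpha> a c)\<^sup>2 + (ap2 \<alpha> b c)\<^sup>2) = 0"
        using that(1) by (simp add: form_inner_eq power2_eq_square)
      then have "\<alpha> = 0"
        using that(1) by (intro form_eqI) (simp_all add: add_nonneg_eq_0_iff)
      with that(2) show False ..
    qed
    ultimately show ?thesis
      by simp
  qed
  then show ?thesis
    unfolding inner_product_on_def
    using form_inner_commute form_inner_add form_inner_scale by blast
qed

text \<open>The trilinear form \<open>form_inner (diamond \<alpha> \<beta>) \<gamma>\<close> is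
  totally symmetric, being the polarization of the cubic form (tr \<alpha>^3 + 3 det \<alpha>) /
  2.\<close>

lemma metrized_form_inner:
  assumes "DIM('v::euclidean_space) = 3"
  shows "metrized_by (sym_forms :: 'v form2 set) diamond form_inner"
proof -
  obtain a b c :: 'v where "frame a b c"
    using exists_frame_Basis[OF assms] .
  then interpret frame a b c .
  show ?thesis
    by (simp add: metrized_by_def diamond_in_sym_forms form_inner_eq diamond_coords field_simps)
qed

context frame
begin

lemma diamond_frame:
  "diamond (a \<odot> a) (a \<odot> a) = (1/2) *\<^sub>R (a \<odot> a)"
  "diamond (a \<odot> a) (b \<odot> b) = (1/4) *\<^sub>R (c \<odot> c)"
  by (rule form_eqI; simp add: sym_forms_closed diamond_in_sym_forms diamond_coords
      blinfun.bilinear_simps sym_tensor_apply inner_frame)+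

lemma diamond_square_diagonal:
  fixes x y z
  defines "\<alpha> \<equiv> x *\<^sub>R (a \<odot> a) + y *\<^sub>R (b \<odot> b) + z *\<^sub>R (c \<odot> c)"
  shows "ap2 (diamond \<alpha> \<alpha>) a a = (x\<^sup>2 + y * z) / 2" "ap2 (diamond \<alpha> \<alpha>) b b = (y\<^sup>2 + x * z) / 2"
    "ap2 (diamond \<alpha> \<alpha>) c c = (z\<^sup>2 + x * y) / 2"
    "ap2 \<alpha> a a = x" "ap2 \<alpha> b b = y" "ap2 \<alpha> c c = z"
  by (simp_all add: \<alpha>_def sym_forms_closed diamond_coords blinfun.bilinear_simps
      sym_tensor_apply inner_frame power2_eq_square field_simps)

end

lemma diamond_square_zero:
  fixes \<alpha> :: "'v::euclidean_space form2"
  assumes "DIM('v) = 3" "\<alpha> \<in> sym_forms" "diamond \<alpha> \<alpha> = 0"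
  shows "\<alpha> = 0"
proof -
  obtain a b c x y z where f: "frame a b c"
    and \<alpha>: "\<alpha> = x *\<^sub>R (a \<odot> a) + y *\<^sub>R (b \<odot> b) + z *\<^sub>R (c \<odot> c)"
    using diagonal_form[OF assms(1,2)] .
  interpret frame a b c by fact
  have eqs: "x\<^sup>2 + y * z = 0" "y\<^sup>2 + x * z = 0" "z\<^sup>2 + x * y = 0"
    using diamond_square_diagonal[of x y z] assms(3) unfolding \<alpha> by simp_all
  \<comment> \<open>This is twice the sum of the three equations.\<close>
  then have "(x + y)\<^sup>2 + (y + z)\<^sup>2 + (x + z)\<^sup>2 = 0"
    by (simp add: power2_eq_square algebra_simps)
  then have "x + y = 0" "y + z = 0" "x + z = 0"
    by (simp_all add: add_nonneg_eq_0_iff)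
  then have "x = 0" "y = 0" "z = 0"
    by linarith+
  then show ?thesis
    by (simp add: \<alpha>)
qed

lemma diamond_idempotent:
  fixes \<alpha> :: "'v::euclidean_space form2"
  assumes "DIM('v) = 3" "\<alpha> \<in> sym_forms" "diamond \<alpha> \<alpha> = \<alpha>" "\<alpha> \<noteq> 0" "\<alpha> \<noteq> hform"
  obtains a b c where "frame a b c" "\<alpha> = 2 *\<^sub>R (a \<odot> a)"
proof -
  obtain a b c x y z where f: "frame a b c"
    and \<alpha>: "\<alpha> = x *\<^sub>R (a \<odot> a) + y *\<^sub>R (b \<odot> b) + z *\<^sub>R (c \<odot> c)"
    using diagonal_form[OF assms(1,2)] .
  interpret frame a b c by fact
  have eqs: "x\<^sup>2 + y * z = 2 * x" "y\<^sup>2 + x * z = 2 * y" "z\<^sup>2 + x * y = 2 * z"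
    using diamond_square_diagonal[of x y z] assms(3) unfolding \<alpha> by simp_all
  have "\<not> (x = 0 \<and> y = 0 \<and> z = 0)" "\<not> (x = 1 \<and> y = 1 \<and> z = 1)"
    using assms(4,5) \<alpha> hform_eq by auto
  \<comment> \<open>Differences of two of the equations, factored.\<close>
  have "(x - y) * (x + y - z - 2) = 0" "(y - z) * (y + z - x - 2) = 0" "(x - z) * (x + z - y - 2) = 0"
    using eqs by algebra+
  then have sol: "x = y \<or> x + y - z = 2" "y = z \<or> y + z - x = 2" "x = z \<or> x + z - y = 2"
    by auto
  \<comment> \<open>A common value x satisfies 2 x^2 = 2 x, which leaves the zero form and
    \<open>hform\<close>.\<close>
  have "\<not> (x = y \<and> y = z)"
    using eqs(1) \<open>\<not> (x = 0 \<and> y = 0 \<and> z = 0)\<close> \<open>\<not> (x = 1 \<and> y = 1 \<and> z = 1)\<close>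
    by (auto simp: power2_eq_square)
  \<comment> \<open>If two entries agree and the third differs, the third is 2. Two relations of the
    type x + y - z = 2 also force two entries to agree, so all three cannot be distinct.\<close>
  with sol consider "x = y" "z = 2" | "y = z" "x = 2" | "x = z" "y = 2"
    by linarith
  then have "x = 2 \<and> y = 0 \<and> z = 0 \<or> x = 0 \<and> y = 2 \<and> z = 0 \<or> x = 0 \<and> y = 0 \<and> z = 2"
    using eqs by cases (auto simp: power2_eq_square)
  then show ?thesis
    using that \<alpha> f rotate frame.rotate[OF rotate] by fastforce
qed

section \<open>Dual bases, dimensions and traces\<close>

text \<open>Coordinates on a subspace: the i-th functional reads off the coefficient of the i-th
  vector. Such paired lists yield both the dimension and traces by evaluating entries.\<close>

locale dual_basis =
  fixes S :: "'a::real_vector set" and xs :: "'a list" and \<phi>s :: "('a \<Rightarrow> real) list"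
  assumes in_S: "set xs \<subseteq> S"
    and subspace: "subspace S"
    and linear: "\<And>\<phi>. \<phi> \<in> set \<phi>s \<Longrightarrow> linear \<phi>"
    and len: "length \<phi>s = length xs"
    and dual: "\<And>i j. i < length xs \<Longrightarrow> j < length xs \<Longrightarrow> (\<phi>s ! i) (xs ! j) = (if i = j then 1 else 0)"
    and expand: "\<And>s. s \<in> S \<Longrightarrow> s = (\<Sum>i<length xs. (\<phi>s ! i) s *\<^sub>R xs ! i)"
begin

lemma linear_nth: "i < length xs \<Longrightarrow> linear (\<phi>s ! i)"
  using linear len by simp

lemma distinct_xs: "distinct xs"
  unfolding distinct_conv_nth
proof (intro allI impI notI)
  fix i j assume "i < length xs" "j < length xs" "i \<noteq> j" "xs ! i = xs ! j"
  then show False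
    using dual[of i i] dual[of i j] by simp
qed

lemma span_xs: "span (set xs) = S"
proof
  show "span (set xs) \<subseteq> S"
    using in_S subspace by (rule span_minimal)
  show "S \<subseteq> span (set xs)"
  proof
    fix s assume "s \<in> S"
    then have "s = (\<Sum>i<length xs. (\<phi>s ! i) s *\<^sub>R xs ! i)"
      by (rule expand)
    also have "\<dots> \<in> span (set xs)"
      by (intro span_sum span_scale span_base) simp
    finally show "s \<in> span (set xs)" .
  qed
qed

lemma independent_xs: "independent (set xs)"
proof (rule independent_if_scalars_zero)
  fix f x assume sum: "(\<Sum>x\<in>set xs. f x *\<^sub>R x) = 0" and "x \<in> set xs"
  then obtain i where i: "i < length xs" "x = xs ! i"
    by (metis in_set_conv_nth)
  have val: "(\<phi>s ! i) y = (if y = x then 1 else 0)" if "y \<in> set xs" for y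
    using that i dual[OF i(1)] distinct_xs by (auto simp: in_set_conv_nth nth_eq_iff_index_eq)
  have "0 = (\<phi>s ! i) (\<Sum>x\<in>set xs. f x *\<^sub>R x)"
    using linear_0[OF linear_nth[OF i(1)]] sum by simp
  also have "\<dots> = (\<Sum>y\<in>set xs. f y * (\<phi>s ! i) y)"
    by (simp add: linear_sum[OF linear_nth[OF i(1)]] linear_scale[OF linear_nth[OF i(1)]])
  also have "\<dots> = (\<Sum>y\<in>set xs. if y = x then f y else 0)"
    by (intro sum.cong) (auto simp: val)
  also have "\<dots> = f x"
    using \<open>x \<in> set xs\<close> by simp
  finally show "f x = 0" ..
qed simp

lemma dim_eq: "dim S = length xs"
  using dim_eq_card[of "set xs" S] independent_xs span_xs distinct_card[OF distinct_xs] subspace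
  by (simp add: span_eq_iff[THEN iffD2])

text \<open>\<open>trace_on\<close> takes its basis from \<open>SOME\<close>, so the formula is
  proved for every basis \<open>B\<close>; this is the independence of the trace from the
  basis.\<close>

lemma trace_on_eq:
  assumes f: "Real_Vector_Spaces.linear f" and closed: "\<And>s. s \<in> S \<Longrightarrow> f s \<in> S"
  shows "trace_on S f = (\<Sum>i<length xs. (\<phi>s ! i) (f (xs ! i)))"
proof -
  have any_basis: "(\<Sum>b\<in>B. representation B (f b) b) = (\<Sum>i<length xs. (\<phi>s ! i) (f (xs ! i)))"
    if B: "independent B" "span B = S" for B
  proof -
    have fin: "finite B"
      using independent_span_bound[of "set xs" B] B span_base[of _ B] span_xs by auto
    have xS: "f (xs ! i) \<in> span B" if "i < length xs" for i
      using closed[of "xs ! i"] in_S nth_mem[OF that] B(2) by blast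
    \<comment> \<open>Expand \<open>b\<close> in \<open>xs\<close>. Once the sums are exchanged, the
      sum over \<open>B\<close> reassembles \<open>f (xs ! i)\<close> inside the functional.\<close>
    have rep: "representation B (f b) b = (\<Sum>i<length xs. (\<phi>s ! i) b * representation B (f (xs ! i)) b)"
      if "b \<in> B" for b
    proof -
      have "b \<in> S"
        using that B(2) span_base by blast
      then have "f b = f (\<Sum>i<length xs. (\<phi>s ! i) b *\<^sub>R xs ! i)"
        using expand[of b] by simp
      also have "\<dots> = (\<Sum>i<length xs. (\<phi>s ! i) b *\<^sub>R f (xs ! i))"
        by (simp add: linear_sum[OF f] linear_scale[OF f])
      finally show ?thesis
        using xS by (simp only:, subst representation_sum[OF B(1)])
          (auto simp: representation_scale[OF B(1)] span_scale)
    qed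
    have "(\<Sum>b\<in>B. representation B (f b) b) =
        (\<Sum>i<length xs. \<Sum>b\<in>B. (\<phi>s ! i) b * representation B (f (xs ! i)) b)"
      by (simp add: rep sum.swap[of _ B])
    also have "\<dots> = (\<Sum>i<length xs. (\<phi>s ! i) (\<Sum>b\<in>B. representation B (f (xs ! i)) b *\<^sub>R b))"
      by (intro sum.cong) (auto simp: linear_sum[OF linear_nth] linear_scale[OF linear_nth] mult.commute)
    also have "\<dots> = (\<Sum>i<length xs. (\<phi>s ! i) (f (xs ! i)))"
      using xS by (intro sum.cong) (auto simp: sum_representation_eq[OF B(1) _ fin order_refl])
    finally show ?thesis .
  qed
  have "\<exists>B. independent B \<and> span B = S"
    using independent_xs span_xs by blast
  from someI_ex[OF this] show ?thesis
    unfolding trace_on_def Let_def by (intro any_basis) auto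
qed

end

lemma linear_coord: "linear (\<lambda>\<alpha>. ap2 \<alpha> u v)"
  by (simp add: linear_iff blinfun.bilinear_simps)

lemma linear_coord_scale: "linear (\<lambda>\<alpha>. r * ap2 \<alpha> u v)"
  by (simp add: linear_iff blinfun.bilinear_simps algebra_simps)

context frame
begin

text \<open>Mixed entries count twice because the functional dual to \<open>a \<odot> b\<close> is
  twice the ab entry.\<close>

lemma trace_on_sym_forms:
  assumes "linear f" "\<And>\<alpha>. \<alpha> \<in> sym_forms \<Longrightarrow> f \<alpha> \<in> sym_forms"
  shows "trace_on sym_forms f =
    ap2 (f (a \<odot> a)) a a + ap2 (f (b \<odot> b)) b b + ap2 (f (c \<odot> c)) c c +
    2 * (ap2 (f (a \<odot> b)) a b + ap2 (f (a \<odot> c)) a c + ap2 (f (b \<odot> c)) b c)"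
proof -
  let ?xs = "[a \<odot> a, b \<odot> b, c \<odot> c, a \<odot> b, a \<odot> c, b \<odot> c]"
  let ?\<phi>s = "[\<lambda>\<alpha>. ap2 \<alpha> a a, \<lambda>\<alpha>. ap2 \<alpha> b b, \<lambda>\<alpha>. ap2 \<alpha> c c,
    \<lambda>\<alpha>. 2 * ap2 \<alpha> a b, \<lambda>\<alpha>. 2 * ap2 \<alpha> a c, \<lambda>\<alpha>. 2 * ap2 \<alpha> b c]"
  interpret dual_basis sym_forms ?xs ?\<phi>s
  proof (rule dual_basis.intro)
    fix \<alpha> :: "'v form2" assume "\<alpha> \<in> sym_forms"
    from sym_form_eq[OF this] show "\<alpha> = (\<Sum>i<length ?xs. (?\<phi>s ! i) \<alpha> *\<^sub>R ?xs ! i)"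
      by (simp add: lessThan_Suc add_ac)
  qed (auto simp: subspace_sym_forms linear_coord linear_coord_scale less_Suc_eq sym_tensor_apply inner_frame)
  show ?thesis
    using trace_on_eq[OF assms] by (simp add: lessThan_Suc)
qed

section \<open>Traces of left multiplications\<close>

lemma trace_on_diamond:
  fixes \<alpha> :: "'v form2"
  assumes "\<alpha> \<in> sym_forms"
  shows "trace_on sym_forms (diamond \<alpha>) = 3/4 * form_tr \<alpha>"
  by (subst trace_on_sym_forms)
     (simp_all add: linear_diamond assms diamond_in_sym_forms diamond_coords form_tr_eq
       sym_tensor_apply inner_frame field_simps)

lemma form_tr_diamond:
  fixes \<alpha> \<beta> :: "'v form2"
  assumes "\<alpha> \<in> sym_forms" "\<beta> \<in> sym_forms"
  shows "form_tr (diamond \<alpha> \<beta>) = (form_inner \<alpha> \<beta> + form_tr \<alpha> * form_tr \<beta>) / 4"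
  by (simp add: assms diamond_coords form_tr_eq form_inner_eq field_simps)

lemma trace_form_diamond:
  fixes \<alpha> \<beta> :: "'v form2"
  assumes "\<alpha> \<in> sym_forms" "\<beta> \<in> sym_forms"
  shows "trace_form sym_forms diamond \<alpha> \<beta> = 5/8 * form_inner \<alpha> \<beta> - form_tr \<alpha> * form_tr \<beta> / 16"
proof -
  have "linear (\<lambda>z. diamond \<alpha> (diamond \<beta> z))"
    using linear_compose[OF linear_diamond linear_diamond] by (simp add: o_def)
  then show ?thesis
    unfolding trace_form_def
    by (subst trace_on_sym_forms)
       (simp_all add: assms diamond_in_sym_forms diamond_coords form_tr_eq form_inner_eq
         sym_tensor_apply inner_frame field_simps)
qed

section \<open>The spectrum of multiplication by a rank one idempotent\<close>

text \<open>The operator \<open>T\<close> below is \<^term>\<open>diamond\<close> by \<open>2 a \<otimes> a\<close> for \<open>\<rho> = 1/2\<close>; other values of \<open>\<rho>\<close> occur for the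
  multiplications to be excluded in the uniqueness proof.\<close>

definition eigen_coords :: "real \<Rightarrow> real \<Rightarrow> 'v form2 \<Rightarrow> bool" where
  "eigen_coords \<rho> k \<alpha> \<longleftrightarrow>
    ap2 \<alpha> a a = k * ap2 \<alpha> a a \<and> \<rho> * ap2 \<alpha> c c = k * ap2 \<alpha> b b \<and>
    \<rho> * ap2 \<alpha> b b = k * ap2 \<alpha> c c \<and> ap2 \<alpha> a b / 2 = k * ap2 \<alpha> a b \<and>
    ap2 \<alpha> a c / 2 = k * ap2 \<alpha> a c \<and> - \<rho> * ap2 \<alpha> b c = k * ap2 \<alpha> b c"

context
  fixes T :: "'v form2 \<Rightarrow> 'v form2" and \<rho> :: real
  assumes T_closed: "\<And>\<alpha>. \<alpha> \<in> sym_forms \<Longrightarrow> T \<alpha> \<in> sym_forms"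
    and T_coords: "\<And>\<alpha>. \<alpha> \<in> sym_forms \<Longrightarrow> ap2 (T \<alpha>) a a = ap2 \<alpha> a a"
      "\<And>\<alpha>. \<alpha> \<in> sym_forms \<Longrightarrow> ap2 (T \<alpha>) b b = \<rho> * ap2 \<alpha> c c"
      "\<And>\<alpha>. \<alpha> \<in> sym_forms \<Longrightarrow> ap2 (T \<alpha>) c c = \<rho> * ap2 \<alpha> b b"
      "\<And>\<alpha>. \<alpha> \<in> sym_forms \<Longrightarrow> ap2 (T \<alpha>) a b = ap2 \<alpha> a b / 2"
      "\<And>\<alpha>. \<alpha> \<in> sym_forms \<Longrightarrow> ap2 (T \<alpha>) a c = ap2 \<alpha> a c / 2"
      "\<And>\<alpha>. \<alpha> \<in> sym_forms \<Longrightarrow> ap2 (T \<alpha>) b c = - \<rho> * ap2 \<alpha> b c"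
begin

text \<open>The six equations nearly decouple. Writing aa for the square of \<open>a\<close> and ab
  for \<open>a \<odot> b\<close>, the eigenvalue is 1 on aa and 1/2 on ab and ac; \<open>T\<close>
  exchanges bb and cc up to the factor \<rho>, which gives \<rho> on bb + cc and -\<rho> on bb - cc;
  and it is -\<rho> on bc.\<close>

lemma eigen_iff:
  assumes "\<alpha> \<in> sym_forms"
  shows "T \<alpha> = k *\<^sub>R \<alpha> \<longleftrightarrow> eigen_coords \<rho> k \<alpha>"
proof
  assume "T \<alpha> = k *\<^sub>R \<alpha>"
  then have "ap2 (T \<alpha>) u v = k * ap2 \<alpha> u v" for u v
    by (simp add: blinfun.bilinear_simps)
  then show "eigen_coords \<rho> k \<alpha>"
    using T_coords[OF assms] unfolding eigen_coords_def by metis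
qed (rule form_eqI; simp add: eigen_coords_def assms T_closed T_coords sym_forms_scale blinfun.bilinear_simps)

lemma subspace_eigenspace: "subspace {\<alpha> \<in> sym_forms. T \<alpha> = k *\<^sub>R \<alpha>}"
proof -
  have "{\<alpha> \<in> sym_forms. T \<alpha> = k *\<^sub>R \<alpha>} = {\<alpha> \<in> sym_forms. eigen_coords \<rho> k \<alpha>}"
    using eigen_iff by blast
  moreover have "eigen_coords \<rho> k (x + y)" if "eigen_coords \<rho> k x" "eigen_coords \<rho> k y" for x y
    using that unfolding eigen_coords_def blinfun.bilinear_simps by (intro conjI) algebra+
  moreover have "eigen_coords \<rho> k (r *\<^sub>R x)" if "eigen_coords \<rho> k x" for r x
    using that unfolding eigen_coords_def blinfun.bilinear_simps real_scaleR_def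
    by (intro conjI) algebra+
  moreover have "eigen_coords \<rho> k 0"
    by (simp add: eigen_coords_def)
  ultimately show ?thesis
    by (simp add: subspace_def sym_forms_closed)
qed

lemmas eigen_simps = eigen_coords_def sym_forms_closed blinfun.bilinear_simps sym_tensor_apply inner_frame

text \<open>The matrix entries listed in \<open>uvs\<close> serve as coordinates on the eigenspace,
  dual to the eigenvectors \<open>xs\<close>.\<close>

lemma multiplicity_eqI:
  assumes len: "length uvs = length xs"
    and eigen: "\<And>x. x \<in> set xs \<Longrightarrow> x \<in> sym_forms \<and> eigen_coords \<rho> k x"
    and dual: "\<And>i j. i < length xs \<Longrightarrow> j < length xs \<Longrightarrow>
      (case uvs ! i of (u, v) \<Rightarrow> ap2 (xs ! j) u v) = (if i = j then 1 else 0)"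
    and expand: "\<And>\<alpha>. \<alpha> \<in> sym_forms \<Longrightarrow> T \<alpha> = k *\<^sub>R \<alpha> \<Longrightarrow>
      \<alpha> = (\<Sum>i<length xs. (case uvs ! i of (u, v) \<Rightarrow> ap2 \<alpha> u v) *\<^sub>R xs ! i)"
  shows "multiplicity_on sym_forms T k = length xs"
proof -
  interpret dual_basis "{\<alpha> \<in> sym_forms. T \<alpha> = k *\<^sub>R \<alpha>}" xs "map (\<lambda>(u, v) \<alpha>. ap2 \<alpha> u v) uvs"
  proof (rule dual_basis.intro)
    show "set xs \<subseteq> {\<alpha> \<in> sym_forms. T \<alpha> = k *\<^sub>R \<alpha>}"
      using eigen by (auto simp only: eigen_iff)
    show "subspace {\<alpha> \<in> sym_forms. T \<alpha> = k *\<^sub>R \<alpha>}"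
      by (rule subspace_eigenspace)
    show "linear \<phi>" if "\<phi> \<in> set (map (\<lambda>(u, v) \<alpha>. ap2 \<alpha> u v) uvs)" for \<phi> :: "'v form2 \<Rightarrow> real"
      using that by (auto simp: linear_coord)
    show "\<alpha> = (\<Sum>i<length xs. (map (\<lambda>(u, v) \<alpha>. ap2 \<alpha> u v) uvs ! i) \<alpha> *\<^sub>R xs ! i)"
      if "\<alpha> \<in> {\<alpha> \<in> sym_forms. T \<alpha> = k *\<^sub>R \<alpha>}" for \<alpha>
      using that expand[of \<alpha>] by (simp add: len case_prod_unfold)
  qed (use dual len in \<open>auto simp: case_prod_unfold\<close>)
  show ?thesis
    using dim_eq by (simp add: multiplicity_on_def)
qed

lemma multiplicity_one:
  assumes "\<rho> = 1/2"
  shows "multiplicity_on sym_forms T 1 = 1"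
proof -
  have "multiplicity_on sym_forms T 1 = length [a \<odot> a]"
  proof (rule multiplicity_eqI[where uvs = "[(a, a)]"])
    fix \<alpha> assume \<alpha>: "\<alpha> \<in> sym_forms" "T \<alpha> = 1 *\<^sub>R \<alpha>"
    have "ap2 \<alpha> b b = 0" "ap2 \<alpha> c c = 0" "ap2 \<alpha> b c = 0" "ap2 \<alpha> a b = 0" "ap2 \<alpha> a c = 0"
      using \<alpha>(2)[unfolded eigen_iff[OF \<alpha>(1)] eigen_coords_def assms] by linarith+
    then show "\<alpha> = (\<Sum>i<length [a \<odot> a]. (case [(a, a)] ! i of (u, v) \<Rightarrow> ap2 \<alpha> u v) *\<^sub>R [a \<odot> a] ! i)"
      by (intro form_eqI) (simp_all add: \<alpha>(1) lessThan_Suc eigen_simps)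
  qed (auto simp: assms eigen_simps)
  then show ?thesis
    by simp
qed

lemma multiplicity_half:
  assumes "\<rho> = 1/2"
  shows "multiplicity_on sym_forms T (1/2) = 3"
proof -
  let ?xs = "[2 *\<^sub>R (a \<odot> b), 2 *\<^sub>R (a \<odot> c), b \<odot> b + c \<odot> c]" and ?uvs = "[(a, b), (a, c), (b, b)]"
  have "multiplicity_on sym_forms T (1/2) = length ?xs"
  proof (rule multiplicity_eqI[where uvs = ?uvs])
    fix \<alpha> assume \<alpha>: "\<alpha> \<in> sym_forms" "T \<alpha> = (1/2) *\<^sub>R \<alpha>"
    have "ap2 \<alpha> c c = ap2 \<alpha> b b" "ap2 \<alpha> a a = 0" "ap2 \<alpha> b c = 0"
      using \<alpha>(2)[unfolded eigen_iff[OF \<alpha>(1)] eigen_coords_def assms] by linarith+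
    then show "\<alpha> = (\<Sum>i<length ?xs. (case ?uvs ! i of (u, v) \<Rightarrow> ap2 \<alpha> u v) *\<^sub>R ?xs ! i)"
      by (intro form_eqI) (simp_all add: \<alpha>(1) lessThan_Suc eigen_simps)
  qed (auto simp: assms eigen_simps less_Suc_eq)
  then show ?thesis
    by simp
qed

lemma multiplicity_minus_half:
  assumes "\<rho> = 1/2"
  shows "multiplicity_on sym_forms T (-1/2) = 2"
proof -
  let ?xs = "[b \<odot> b - c \<odot> c, 2 *\<^sub>R (b \<odot> c)]" and ?uvs = "[(b, b), (b, c)]"
  have "multiplicity_on sym_forms T (-1/2) = length ?xs"
  proof (rule multiplicity_eqI[where uvs = ?uvs])
    fix \<alpha> assume \<alpha>: "\<alpha> \<in> sym_forms" "T \<alpha> = (-1/2) *\<^sub>R \<alpha>"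
    have "ap2 \<alpha> c c = - ap2 \<alpha> b b" "ap2 \<alpha> a a = 0" "ap2 \<alpha> a b = 0" "ap2 \<alpha> a c = 0"
      using \<alpha>(2)[unfolded eigen_iff[OF \<alpha>(1)] eigen_coords_def assms] by linarith+
    then show "\<alpha> = (\<Sum>i<length ?xs. (case ?uvs ! i of (u, v) \<Rightarrow> ap2 \<alpha> u v) *\<^sub>R ?xs ! i)"
      by (intro form_eqI) (simp_all add: \<alpha>(1) lessThan_Suc eigen_simps)
  qed (auto simp: assms eigen_simps less_Suc_eq)
  then show ?thesis
    by simp
qed

lemma spectrum:
  assumes "\<rho> = 1/2"
  shows "spectrum_on sym_forms T = {1, 1/2, -1/2}"
proof (intro equalityI subsetI)
  fix k assume "k \<in> spectrum_on sym_forms T"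
  then obtain \<alpha> where \<alpha>: "\<alpha> \<in> sym_forms" "\<alpha> \<noteq> 0" "T \<alpha> = k *\<^sub>R \<alpha>"
    by (auto simp: spectrum_on_def)
  show "k \<in> {1, 1/2, -1/2}"
  proof (rule ccontr)
    assume k: "k \<notin> {1, 1/2, -1/2}"
    note eqs = \<alpha>(3)[unfolded eigen_iff[OF \<alpha>(1)] eigen_coords_def assms]
    \<comment> \<open>Eliminating between the equations for bb and cc leaves the factor k^2 - 1/4 on
      either entry.\<close>
    have "(k - 1/2) * (k + 1/2) * ap2 \<alpha> b b = 0" "(k - 1/2) * (k + 1/2) * ap2 \<alpha> c c = 0"
      "(k + 1/2) * ap2 \<alpha> b c = 0"
      using eqs by algebra+
    then have "ap2 \<alpha> b b = 0" "ap2 \<alpha> c c = 0" "ap2 \<alpha> b c = 0"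
      using k by (auto simp: add_eq_0_iff)
    moreover have "ap2 \<alpha> a a = 0" "ap2 \<alpha> a b = 0" "ap2 \<alpha> a c = 0"
      using k eqs by auto
    ultimately have "\<alpha> = 0"
      using \<alpha>(1) by (intro form_eqI) simp_all
    with \<alpha>(2) show False ..
  qed
next
  have wit: "k \<in> spectrum_on sym_forms T" if "\<alpha> \<in> sym_forms" "ap2 \<alpha> u v \<noteq> 0" "T \<alpha> = k *\<^sub>R \<alpha>" for k \<alpha> u v
    using that by (force simp: spectrum_on_def)
  have "1 \<in> spectrum_on sym_forms T"
    by (rule wit[of "a \<odot> a" a a], simp_all only: eigen_iff sym_tensor_in_sym_forms) (simp_all add: assms eigen_simps)
  moreover have "1/2 \<in> spectrum_on sym_forms T"
    by (rule wit[of "a \<odot> b" a b], simp_all only: eigen_iff sym_tensor_in_sym_forms) (simp_all add: assms eigen_simps)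
  moreover have "-1/2 \<in> spectrum_on sym_forms T"
    by (rule wit[of "b \<odot> c" b c], simp_all only: eigen_iff sym_tensor_in_sym_forms) (simp_all add: assms eigen_simps)
  ultimately show "k \<in> spectrum_on sym_forms T" if "k \<in> {1, 1/2, -1/2}" for k
    using that by blast
qed

text \<open>The eigenvalue 1/2 always occurs on ab and ac. For \<rho> = 1/2 it is joined by bb + cc,
  for \<rho> = -1/2 by both bb - cc and bc, and otherwise by nothing: the multiplicities are 3, 4
  and 2.\<close>

lemma multiplicity_half_eq_3_imp:
  assumes mult: "multiplicity_on sym_forms T (1/2) = 3"
  shows "\<rho> = 1/2"
proof (rule ccontr)
  assume half: "\<rho> \<noteq> 1/2"
  show False
  proof (cases "\<rho> = -1/2")
    case True
    let ?xs = "[2 *\<^sub>R (a \<odot> b), 2 *\<^sub>R (a \<odot> c), b \<odot> b - c \<odot> c, 2 *\<^sub>R (b \<odot> c)]"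
    let ?uvs = "[(a, b), (a, c), (b, b), (b, c)]"
    have "multiplicity_on sym_forms T (1/2) = length ?xs"
    proof (rule multiplicity_eqI[where uvs = ?uvs])
      fix \<alpha> assume \<alpha>: "\<alpha> \<in> sym_forms" "T \<alpha> = (1/2) *\<^sub>R \<alpha>"
      have "ap2 \<alpha> c c = - ap2 \<alpha> b b" "ap2 \<alpha> a a = 0"
        using \<alpha>(2)[unfolded eigen_iff[OF \<alpha>(1)] eigen_coords_def True] by linarith+
      then show "\<alpha> = (\<Sum>i<length ?xs. (case ?uvs ! i of (u, v) \<Rightarrow> ap2 \<alpha> u v) *\<^sub>R ?xs ! i)"
        by (intro form_eqI) (simp_all add: \<alpha>(1) lessThan_Suc eigen_simps)
    qed (auto simp: True eigen_simps less_Suc_eq)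
    with mult show False
      by simp
  next
    case False
    let ?xs = "[2 *\<^sub>R (a \<odot> b), 2 *\<^sub>R (a \<odot> c)]" and ?uvs = "[(a, b), (a, c)]"
    have "multiplicity_on sym_forms T (1/2) = length ?xs"
    proof (rule multiplicity_eqI[where uvs = ?uvs])
      fix \<alpha> assume \<alpha>: "\<alpha> \<in> sym_forms" "T \<alpha> = (1/2) *\<^sub>R \<alpha>"
      note eqs = \<alpha>(2)[unfolded eigen_iff[OF \<alpha>(1)] eigen_coords_def]
      have "(\<rho> - 1/2) * (\<rho> + 1/2) * ap2 \<alpha> b b = 0" "(\<rho> - 1/2) * (\<rho> + 1/2) * ap2 \<alpha> c c = 0"
        "(\<rho> + 1/2) * ap2 \<alpha> b c = 0" "ap2 \<alpha> a a = 0"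
        using eqs by algebra+
      moreover have "\<rho> + 1/2 \<noteq> 0"
        using False by linarith
      ultimately have "ap2 \<alpha> b b = 0" "ap2 \<alpha> c c = 0" "ap2 \<alpha> b c = 0" "ap2 \<alpha> a a = 0"
        using half by simp_all
      then show "\<alpha> = (\<Sum>i<length ?xs. (case ?uvs ! i of (u, v) \<Rightarrow> ap2 \<alpha> u v) *\<^sub>R ?xs ! i)"
        by (intro form_eqI) (simp_all add: \<alpha>(1) lessThan_Suc eigen_simps)
    qed (auto simp: eigen_simps less_Suc_eq)
    with mult show False
      by simp
  qed
qed

end

lemma diamond_idempotent_coords:
  assumes "\<alpha> \<in> sym_forms"
  shows "ap2 (diamond (2 *\<^sub>R (a \<odot> a)) \<alpha>) a a = ap2 \<alpha> a a"
    "ap2 (diamond (2 *\<^sub>R (a \<odot> a)) \<alpha>) b b = 1/2 * ap2 \<alpha> c c"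
    "ap2 (diamond (2 *\<^sub>R (a \<odot> a)) \<alpha>) c c = 1/2 * ap2 \<alpha> b b"
    "ap2 (diamond (2 *\<^sub>R (a \<odot> a)) \<alpha>) a b = ap2 \<alpha> a b / 2"
    "ap2 (diamond (2 *\<^sub>R (a \<odot> a)) \<alpha>) a c = ap2 \<alpha> a c / 2"
    "ap2 (diamond (2 *\<^sub>R (a \<odot> a)) \<alpha>) b c = - (1/2) * ap2 \<alpha> b c"
  by (simp_all add: assms sym_forms_closed diamond_coords blinfun.bilinear_simps
      sym_tensor_apply inner_frame)

lemma diamond_idempotent_closed: "\<alpha> \<in> sym_forms \<Longrightarrow> diamond (2 *\<^sub>R (a \<odot> a)) \<alpha> \<in> sym_forms"
  by (intro diamond_in_sym_forms sym_forms_scale sym_tensor_in_sym_forms)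

lemmas diamond_idempotent_spectrum =
  spectrum[OF diamond_idempotent_closed diamond_idempotent_coords refl]
  multiplicity_one[OF diamond_idempotent_closed diamond_idempotent_coords refl]
  multiplicity_half[OF diamond_idempotent_closed diamond_idempotent_coords refl]
  multiplicity_minus_half[OF diamond_idempotent_closed diamond_idempotent_coords refl]

text \<open>Multiplication by \<open>hform\<close> has eigenvalue 1 on \<open>hform\<close> and 1/4
  on trace-free forms, so the product sees the trace once \<open>hform\<close> is
  recognized.\<close>

lemma diamond_hform:
  fixes \<alpha> :: "'v form2"
  assumes "\<alpha> \<in> sym_forms"
  shows "diamond hform \<alpha> = (1/4) *\<^sub>R (\<alpha> + form_tr \<alpha> *\<^sub>R hform)"
  by (rule form_eqI)
     (simp_all add: assms diamond_in_sym_forms sym_forms_closed diamond_coords hform_coords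
       form_tr_eq blinfun.bilinear_simps field_simps)

end

section \<open>Simplicity\<close>

lemma simple_diamond:
  assumes dim: "DIM('v::euclidean_space) = 3"
  shows "simple_algebra (sym_forms :: 'v form2 set) diamond"
  unfolding simple_algebra_def
proof (intro conjI allI impI)
  obtain a b c :: 'v where "frame a b c"
    using exists_frame_Basis[OF dim] .
  then interpret frame a b c .
  have "ap2 (diamond (a \<odot> a) (a \<odot> a)) a a \<noteq> 0"
    by (simp add: diamond_frame blinfun.bilinear_simps sym_tensor_apply inner_frame)
  then have "diamond (a \<odot> a) (a \<odot> a) \<noteq> 0"
    by force
  then show "\<exists>x\<in>sym_forms. \<exists>y\<in>sym_forms. diamond x y \<noteq> (0 :: 'v form2)"
    by (meson sym_tensor_in_sym_forms)
next
  fix I :: "'v form2 set"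
  assume I: "subspace I \<and> I \<subseteq> sym_forms \<and> (\<forall>x\<in>sym_forms. \<forall>y\<in>I. diamond x y \<in> I \<and> diamond y x \<in> I)"
  then have sub: "subspace I" and ideal: "\<And>x y. x \<in> sym_forms \<Longrightarrow> y \<in> I \<Longrightarrow> diamond x y \<in> I"
    by auto
  \<comment> \<open>One diagonal form with nonzero first entry in the ideal suffices. The frame is
    kept arbitrary because it will be rotated.\<close>
  have full: "sym_forms \<subseteq> I" if f: "frame a b c" and "x *\<^sub>R (a \<odot> a) + y *\<^sub>R (b \<odot> b) + z *\<^sub>R (c \<odot> c) \<in> I" and "x \<noteq> 0"
    for a b c :: 'v and x y z
  proof -
    interpret frame a b c by fact
    define \<alpha> where "\<alpha> = x *\<^sub>R (a \<odot> a) + y *\<^sub>R (b \<odot> b) + z *\<^sub>R (c \<odot> c)"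
    have "\<alpha> \<in> I"
      using that by (simp add: \<alpha>_def)
    \<comment> \<open>Multiplication by aa has eigenvalue 1/2 on aa, and 1/4 and -1/4 on the span of
      bb and cc. Its square minus 1/16 annihilates that span and leaves 1/4 - 1/16 = 3/16 on
      aa.\<close>
    then have "diamond (a \<odot> a) (diamond (a \<odot> a) \<alpha>) - (1/16) *\<^sub>R \<alpha> \<in> I"
      by (intro subspace_diff subspace_scale sub ideal) simp_all
    also have "diamond (a \<odot> a) (diamond (a \<odot> a) \<alpha>) - (1/16) *\<^sub>R \<alpha> = (3/16 * x) *\<^sub>R (a \<odot> a)"
      by (rule form_eqI) (simp_all add: \<alpha>_def sym_forms_closed diamond_in_sym_forms diamond_coords
          blinfun.bilinear_simps sym_tensor_apply inner_frame)
    finally have "(1 / (3/16 * x)) *\<^sub>R (3/16 * x) *\<^sub>R (a \<odot> a) \<in> I"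
      by (rule subspace_scale[OF sub])
    then have a: "a \<odot> a \<in> I"
      using \<open>x \<noteq> 0\<close> by simp
    \<comment> \<open>The product of two frame squares is a quarter of the third, so the other
      squares follow from the first.\<close>
    have "4 *\<^sub>R diamond (b \<odot> b) (a \<odot> a) \<in> I" "4 *\<^sub>R diamond (c \<odot> c) (a \<odot> a) \<in> I"
      using a by (intro subspace_scale sub ideal; simp)+
    then have "c \<odot> c \<in> I" "b \<odot> b \<in> I"
      using frame.diamond_frame(2)[OF swap12] frame.diamond_frame(2)[OF frame.rotate[OF rotate]] by simp_all
    with a have h: "hform \<in> I"
      unfolding hform_eq by (intro subspace_add sub)
    show "sym_forms \<subseteq> I"
    proof
      fix \<beta> :: "'v form2" assume \<beta>: "\<beta> \<in> sym_forms"
      \<comment> \<open>By \<open>diamond_hform\<close> this combination is \<beta> itself.\<close>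
      have "4 *\<^sub>R diamond \<beta> hform - form_tr \<beta> *\<^sub>R hform \<in> I"
        using h \<beta> by (intro subspace_diff subspace_scale sub ideal)
      then show "\<beta> \<in> I"
        by (simp add: diamond_commute[of \<beta>] diamond_hform[OF \<beta>])
    qed
  qed
  show "I = {0} \<or> I = sym_forms"
  proof (cases "I \<subseteq> {0}")
    case True
    then show ?thesis
      using subspace_0[OF sub] by auto
  next
    case False
    then obtain \<alpha> where \<alpha>: "\<alpha> \<in> I" "\<alpha> \<noteq> 0"
      by auto
    then obtain a b c x y z where f: "frame a b c"
      and eq: "\<alpha> = x *\<^sub>R (a \<odot> a) + y *\<^sub>R (b \<odot> b) + z *\<^sub>R (c \<odot> c)"
      using diagonal_form[OF dim, of \<alpha>] I by blast
    interpret frame a b c by fact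
    have "sym_forms \<subseteq> I"
    proof -
      have "x \<noteq> 0 \<or> y \<noteq> 0 \<or> z \<noteq> 0"
        using \<alpha>(2) eq by auto
      then consider "x \<noteq> 0" | "y \<noteq> 0" | "z \<noteq> 0"
        by blast
      then show ?thesis
        using full[OF f, of x y z] full[OF rotate, of y z x] full[OF frame.rotate[OF rotate], of z x y]
          \<alpha>(1) eq by cases (simp_all add: add_ac)
    qed
    with I show ?thesis
      by auto
  qed
qed


section \<open>The characterizing conditions\<close>

lemma diamond_idempotent_nontrivial:
  fixes \<alpha> :: "'v::euclidean_space form2"
  assumes "DIM('v) = 3" "\<alpha> \<in> sym_forms" "diamond \<alpha> \<alpha> = \<alpha>" "\<alpha> \<notin> range (\<lambda>c. c *\<^sub>R hform)"
  obtains a b c where "frame a b c" "\<alpha> = 2 *\<^sub>R (a \<odot> a)"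
proof -
  have "0 *\<^sub>R hform \<in> range (\<lambda>c. c *\<^sub>R (hform :: 'v form2))" "1 *\<^sub>R hform \<in> range (\<lambda>c. c *\<^sub>R (hform :: 'v form2))"
    by blast+
  then have "\<alpha> \<noteq> 0" "\<alpha> \<noteq> hform"
    using assms(4) by auto
  then show ?thesis
    using diamond_idempotent[OF assms(1-3)] that by blast
qed

lemma frame_nonzero: "frame a b c \<Longrightarrow> a \<noteq> 0"
  using frame.unit(1) by fastforce

lemma characterizing_conditions_diamond:
  assumes dim: "DIM('v::euclidean_space) = 3"
  shows "characterizing_conditions (form_inner :: 'v form2 \<Rightarrow> 'v form2 \<Rightarrow> real) diamond"
  unfolding characterizing_conditions_def
proof (intro conjI)
  show "\<forall>f :: 'v \<Rightarrow> 'v. orthogonal_transformation f \<longrightarrow>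
      algebra_isomorphism sym_forms diamond sym_forms diamond (orth_act f)"
    using algebra_isomorphism_orth_act[OF dim] by blast
  show "inner_product_on (sym_forms :: 'v form2 set) form_inner"
    by (rule inner_product_form_inner[OF dim])
  show "orth_invariant (form_inner :: 'v form2 \<Rightarrow> 'v form2 \<Rightarrow> real)"
    using form_inner_orth_act[OF dim] by (auto simp: orth_invariant_def)
  show "metrized_by (sym_forms :: 'v form2 set) diamond form_inner"
    by (rule metrized_form_inner[OF dim])
  show "\<forall>\<alpha>\<in>sym_forms. diamond \<alpha> \<alpha> = 0 \<longrightarrow> \<alpha> = (0 :: 'v form2)"
    using diamond_square_zero[OF dim] by blast
  obtain a b c :: 'v where "frame a b c"
    using exists_frame_Basis[OF dim] .
  then interpret frame a b c .
  have "diamond (2 *\<^sub>R (a \<odot> a)) (2 *\<^sub>R (a \<odot> a)) = 2 *\<^sub>R (a \<odot> a)"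
    using diamond_frame(1) by (simp add: diamond_scale diamond_commute[of "a \<odot> a" "2 *\<^sub>R (a \<odot> a)"])
  moreover have "form_rank (2 *\<^sub>R (a \<odot> a)) = 1"
    using unit by (intro form_rank_square) auto
  ultimately show "\<exists>e\<in>sym_forms. diamond e e = e \<and> form_rank (e :: 'v form2) = 1"
    by (meson sym_forms_scale sym_tensor_in_sym_forms)
  show "\<forall>e\<in>sym_forms. diamond e e = e \<and> e \<notin> range (\<lambda>c. c *\<^sub>R hform) \<longrightarrow> form_rank (e :: 'v form2) = 1"
    using diamond_idempotent_nontrivial[OF dim] form_rank_square frame_nonzero
    by (metis zero_neq_numeral)
  show "\<forall>e\<in>sym_forms. diamond e e = e \<and> form_rank (e :: 'v form2) = 1 \<longrightarrow>
      multiplicity_on sym_forms (diamond e) (1/2) = 3"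
  proof (intro ballI impI)
    fix e :: "'v form2" assume e: "e \<in> sym_forms" "diamond e e = e \<and> form_rank e = 1"
    then have "e \<notin> range (\<lambda>c. c *\<^sub>R hform)"
      using form_rank_hform_multiple[OF dim] by auto
    then obtain a b c where "frame a b c" "e = 2 *\<^sub>R (a \<odot> a)"
      using diamond_idempotent_nontrivial[OF dim] e by metis
    then show "multiplicity_on sym_forms (diamond e) (1/2) = 3"
      by (simp add: frame.diamond_idempotent_spectrum)
  qed
qed


section \<open>Uniqueness\<close>

text \<open>Commutativity and condition (1) by themselves reduce the products of frame squares to
  four constants; the metric and the idempotents enter afterwards.\<close>

locale invariant_algebra =
  fixes m :: "'v::euclidean_space form2 \<Rightarrow> 'v form2 \<Rightarrow> 'v form2"
  assumes dim: "DIM('v) = 3"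
    and algebra: "commutative_algebra sym_forms m"
    and invariant: "\<And>g. orthogonal_transformation g \<Longrightarrow>
      algebra_isomorphism sym_forms m sym_forms m (orth_act g)"
begin

lemma m_closed: "\<alpha> \<in> sym_forms \<Longrightarrow> \<beta> \<in> sym_forms \<Longrightarrow> m \<alpha> \<beta> \<in> sym_forms"
  and m_commute: "\<alpha> \<in> sym_forms \<Longrightarrow> \<beta> \<in> sym_forms \<Longrightarrow> m \<alpha> \<beta> = m \<beta> \<alpha>"
  and m_add: "\<alpha> \<in> sym_forms \<Longrightarrow> \<beta> \<in> sym_forms \<Longrightarrow> \<gamma> \<in> sym_forms \<Longrightarrow> m (\<alpha> + \<beta>) \<gamma> = m \<alpha> \<gamma> + m \<beta> \<gamma>"
  and m_scale: "\<alpha> \<in> sym_forms \<Longrightarrow> \<gamma> \<in> sym_forms \<Longrightarrow> m (r *\<^sub>R \<alpha>) \<gamma> = r *\<^sub>R m \<alpha> \<gamma>"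
  using algebra unfolding commutative_algebra_def by blast+

lemma m_add_right:
  assumes "\<alpha> \<in> sym_forms" "\<beta> \<in> sym_forms" "\<gamma> \<in> sym_forms"
  shows "m \<gamma> (\<alpha> + \<beta>) = m \<gamma> \<alpha> + m \<gamma> \<beta>"
  using assms m_add[OF assms] by (simp add: m_commute[of \<gamma>] sym_forms_closed)

lemma m_scale_right: "\<alpha> \<in> sym_forms \<Longrightarrow> \<gamma> \<in> sym_forms \<Longrightarrow> m \<gamma> (r *\<^sub>R \<alpha>) = r *\<^sub>R m \<gamma> \<alpha>"
  by (simp add: m_commute[of \<gamma>] sym_forms_closed m_scale)

lemma square_coord:
  assumes "orthogonal_transformation g"
  shows "ap2 (m (g u \<odot> g u) (g v \<odot> g v)) (g x) (g y) = ap2 (m (u \<odot> u) (v \<odot> v)) x y"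
proof -
  have "orth_act g (m (u \<odot> u) (v \<odot> v)) = m (g u \<odot> g u) (g v \<odot> g v)"
    using invariant[OF assms] by (simp add: algebra_isomorphism_def orth_act_sym_tensor[OF assms])
  then show ?thesis
    using orth_act_apply_image[OF assms] by metis
qed

text \<open>The reflection of \<open>a\<close> to \<open>- a\<close> fixes the squares of all frame
  vectors but reverses the sign of the ab entry.\<close>

lemma square_coord_off_diagonal:
  assumes "frame a b c" "u \<in> {a, b, c}" "v \<in> {a, b, c}"
  shows "ap2 (m (u \<odot> u) (v \<odot> v)) a b = 0"
proof -
  interpret frame a b c by fact
  have "frame ((-1) *\<^sub>R a) (1 *\<^sub>R b) (1 *\<^sub>R c)"
    by (rule scale_frame) simp_all
  then have "frame (- a) b c"
    by simp
  then obtain g where g: "orthogonal_transformation g" "g a = - a" "g b = b" "g c = c"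
    using transformation_to_frame by blast
  have "(- a) \<odot> (- a) = a \<odot> a"
    using sym_tensor_scale[of "-1" a "-1" a] by simp
  then have "g u \<odot> g u = u \<odot> u" "g v \<odot> g v = v \<odot> v"
    using assms(2,3) g by auto
  then show ?thesis
    using square_coord[OF g(1), of u v a b] g by (simp add: blinfun.bilinear_simps)
qed

text \<open>By transitivity on frames the diagonal entries do not depend on the frame. Exchanging b
  and c equates two entries of the product of aa with itself; exchanging a and b, with
  commutativity, equates two entries of the product of aa and bb.\<close>

lemma structure_constants:
  "\<exists>A B C D. \<forall>a b c. frame a b c \<longrightarrow> m (a \<odot> a) (a \<odot> a) = A *\<^sub>R (a \<odot> a) + C *\<^sub>R (b \<odot> b + c \<odot> c) \<and>
    m (a \<odot> a) (b \<odot> b) = B *\<^sub>R (a \<odot> a + b \<odot> b) + D *\<^sub>R (c \<odot> c)"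
proof -
  obtain a' b' c' :: 'v where f': "frame a' b' c'"
    using exists_frame_Basis[OF dim] .
  define A C B D where
    "A = ap2 (m (a' \<odot> a') (a' \<odot> a')) a' a'" and "C = ap2 (m (a' \<odot> a') (a' \<odot> a')) b' b'" and
    "B = ap2 (m (a' \<odot> a') (b' \<odot> b')) a' a'" and "D = ap2 (m (a' \<odot> a') (b' \<odot> b')) c' c'"
  have coords: "ap2 (m (a \<odot> a) (a \<odot> a)) a a = A" "ap2 (m (a \<odot> a) (a \<odot> a)) b b = C"
    "ap2 (m (a \<odot> a) (b \<odot> b)) a a = B" "ap2 (m (a \<odot> a) (b \<odot> b)) c c = D" if f: "frame a b c" for a b c :: 'v
  proof -
    obtain g where "orthogonal_transformation g" "g a' = a" "g b' = b" "g c' = c"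
      using frame.transformation_to_frame[OF f' f] by blast
    then show "ap2 (m (a \<odot> a) (a \<odot> a)) a a = A" "ap2 (m (a \<odot> a) (a \<odot> a)) b b = C"
      "ap2 (m (a \<odot> a) (b \<odot> b)) a a = B" "ap2 (m (a \<odot> a) (b \<odot> b)) c c = D"
      unfolding A_def B_def C_def D_def using square_coord by blast+
  qed
  show ?thesis
  proof (rule exI[of _ A], rule exI[of _ B], rule exI[of _ C], rule exI[of _ D], intro allI impI)
    fix a b c :: 'v assume f: "frame a b c"
    interpret frame a b c by fact
    have off: "ap2 (m (u \<odot> u) (v \<odot> v)) a b = 0" "ap2 (m (u \<odot> u) (v \<odot> v)) a c = 0"
      "ap2 (m (u \<odot> u) (v \<odot> v)) b c = 0" if "u \<in> {a, b, c}" "v \<in> {a, b, c}" for u v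
      using that square_coord_off_diagonal[OF f] square_coord_off_diagonal[OF swap23]
        square_coord_off_diagonal[OF rotate] by blast+
    have "ap2 (m (a \<odot> a) (b \<odot> b)) b b = B"
      using coords(3)[OF swap12] by (simp add: m_commute[of "a \<odot> a"])
    then show "m (a \<odot> a) (a \<odot> a) = A *\<^sub>R (a \<odot> a) + C *\<^sub>R (b \<odot> b + c \<odot> c) \<and>
      m (a \<odot> a) (b \<odot> b) = B *\<^sub>R (a \<odot> a + b \<odot> b) + D *\<^sub>R (c \<odot> c)"
      using coords[OF f] coords(2)[OF swap23] off
      by (auto intro!: form_eqI simp: m_closed sym_forms_closed blinfun.bilinear_simps sym_tensor_apply inner_frame)
  qed
qed

text \<open>Every symmetric form is diagonal in some frame, so squares are computed without knowing \<open>m\<close> on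
  products of distinct frame vectors; polarization does the rest.\<close>

lemma eq_combination:
  assumes sq: "\<And>a b c. frame a b c \<Longrightarrow> m (a \<odot> a) (a \<odot> a) = A *\<^sub>R (a \<odot> a)"
    and pr: "\<And>a b c. frame a b c \<Longrightarrow> m (a \<odot> a) (b \<odot> b) = D *\<^sub>R (c \<odot> c)"
    and "\<alpha> \<in> sym_forms" "\<beta> \<in> sym_forms"
  shows "m \<alpha> \<beta> = (A - 2 * D) *\<^sub>R sym_product \<alpha> \<beta> + (4 * D) *\<^sub>R diamond \<alpha> \<beta>"
proof -
  \<comment> \<open>In a frame \<open>sym_product\<close> sends (aa, aa) to aa and (aa, bb) to 0,
    while \<open>diamond\<close> sends them to aa / 2 and cc / 4. These coefficients are the ones
    that reproduce \<open>A\<close> and \<open>D\<close>.\<close>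
  define n where "n \<alpha> \<beta> = (A - 2 * D) *\<^sub>R sym_product \<alpha> \<beta> + (4 * D) *\<^sub>R diamond \<alpha> \<beta>" for \<alpha> \<beta> :: "'v form2"
  have diag: "m \<alpha> \<alpha> = n \<alpha> \<alpha>" if \<alpha>: "\<alpha> \<in> sym_forms" for \<alpha>
  proof -
    obtain a b c x y z where f: "frame a b c"
      and eq: "\<alpha> = x *\<^sub>R (a \<odot> a) + y *\<^sub>R (b \<odot> b) + z *\<^sub>R (c \<odot> c)"
      using diagonal_form[OF dim \<alpha>] .
    interpret frame a b c by fact
    note rot = rotate frame.rotate[OF rotate]
    define X Y Z where XYZ: "X = a \<odot> a" "Y = b \<odot> b" "Z = c \<odot> c"
    have mem [simp]: "X \<in> sym_forms" "Y \<in> sym_forms" "Z \<in> sym_forms"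
      by (simp_all add: XYZ)
    have prods: "m X X = A *\<^sub>R X" "m Y Y = A *\<^sub>R Y" "m Z Z = A *\<^sub>R Z"
      "m X Y = D *\<^sub>R Z" "m Y Z = D *\<^sub>R X" "m Z X = D *\<^sub>R Y"
      using sq[OF f] sq[OF rot(1)] sq[OF rot(2)] pr[OF f] pr[OF rot(1)] pr[OF rot(2)]
      unfolding XYZ by blast+
    then have "m Y X = D *\<^sub>R Z" "m Z Y = D *\<^sub>R X" "m X Z = D *\<^sub>R Y"
      using m_commute[of Y X] m_commute[of Z Y] m_commute[of X Z] by simp_all
    with prods have "m \<alpha> \<alpha> =
        x *\<^sub>R (x *\<^sub>R A *\<^sub>R X + y *\<^sub>R D *\<^sub>R Z + z *\<^sub>R D *\<^sub>R Y) +
        y *\<^sub>R (x *\<^sub>R D *\<^sub>R Z + y *\<^sub>R A *\<^sub>R Y + z *\<^sub>R D *\<^sub>R X) +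
        z *\<^sub>R (x *\<^sub>R D *\<^sub>R Y + y *\<^sub>R D *\<^sub>R X + z *\<^sub>R A *\<^sub>R Z)"
      unfolding eq XYZ[symmetric]
      by (simp only: m_add m_add_right m_scale m_scale_right sym_forms_closed mem)
    also have "\<dots> = n \<alpha> \<alpha>"
      by (rule form_eqI)
         (simp_all add: n_def eq XYZ sym_forms_closed sym_product_in_sym_forms diamond_in_sym_forms diamond_coords
            sym_product_eq blinfun.bilinear_simps sym_tensor_apply inner_frame power2_eq_square algebra_simps)
    finally show ?thesis .
  qed
  have n_add: "n (\<alpha> + \<beta>) \<gamma> = n \<alpha> \<gamma> + n \<beta> \<gamma>" and n_commute: "n \<alpha> \<beta> = n \<beta> \<alpha>" for \<alpha> \<beta> \<gamma>
    by (simp_all add: n_def sym_product_add diamond_add sym_product_commute[of \<alpha> \<beta>]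
        diamond_commute[of \<alpha> \<beta>] algebra_simps)
  have "m \<alpha> \<alpha> + 2 *\<^sub>R m \<alpha> \<beta> + m \<beta> \<beta> = m (\<alpha> + \<beta>) (\<alpha> + \<beta>)"
    using assms(3,4) by (simp add: m_add m_add_right m_commute[of \<beta> \<alpha>] sym_forms_closed scaleR_2)
  also have "\<dots> = n (\<alpha> + \<beta>) (\<alpha> + \<beta>)"
    using assms(3,4) by (intro diag sym_forms_closed)
  also have "\<dots> = n \<alpha> \<alpha> + 2 *\<^sub>R n \<alpha> \<beta> + n \<beta> \<beta>"
    using n_add[of \<alpha> \<beta> "\<alpha> + \<beta>"] n_add[of \<alpha> \<beta> \<alpha>] n_add[of \<alpha> \<beta> \<beta>]
      n_commute[of \<alpha> "\<alpha> + \<beta>"] n_commute[of \<beta> "\<alpha> + \<beta>"] n_commute[of \<beta> \<alpha>]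
    by (simp add: scaleR_2)
  finally have "2 *\<^sub>R m \<alpha> \<beta> = 2 *\<^sub>R n \<alpha> \<beta>"
    using diag assms(3,4) by simp
  then show ?thesis
    by (simp add: n_def)
qed

end

lemma inner_product_on_commute: "inner_product_on A g \<Longrightarrow> x \<in> A \<Longrightarrow> y \<in> A \<Longrightarrow> g x y = g y x"
  and inner_product_on_scale: "inner_product_on A g \<Longrightarrow> x \<in> A \<Longrightarrow> y \<in> A \<Longrightarrow> g (r *\<^sub>R x) y = r * g x y"
  and inner_product_on_add:
    "inner_product_on A g \<Longrightarrow> x \<in> A \<Longrightarrow> y \<in> A \<Longrightarrow> z \<in> A \<Longrightarrow> g (x + y) z = g x z + g y z"
  and inner_product_on_pos: "inner_product_on A g \<Longrightarrow> x \<in> A \<Longrightarrow> x \<noteq> 0 \<Longrightarrow> g x x > 0"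
  by (simp_all add: inner_product_on_def)

text \<open>Moving a factor aa across \<open>g\<close> gives 2 g(aa, bb) = g(aa, cc) and 2 g(aa, cc)
  = g(aa, bb), so both vanish. Moving cc instead, with bb \<diamond> cc = aa / 4 and aa \<diamond>
  cc = bb / 4, gives equal norms.\<close>

lemma diamond_metrizing_form:
  assumes f: "frame a b c" and g: "inner_product_on sym_forms g" and met: "metrized_by sym_forms diamond g"
  shows "g (a \<odot> a) (b \<odot> b) = 0" "g (a \<odot> a) (a \<odot> a) = g (b \<odot> b) (b \<odot> b)" "g (a \<odot> a) (a \<odot> a) > 0"
proof -
  interpret frame a b c by fact
  have met: "g (diamond x y) z = g x (diamond y z)" if "x \<in> sym_forms" "y \<in> sym_forms" "z \<in> sym_forms" for x y z
    using met that by (simp add: metrized_by_def)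
  have scale: "g (r *\<^sub>R x) y = r * g x y" "g y (r *\<^sub>R x) = r * g y x"
    if "x \<in> sym_forms" "y \<in> sym_forms" for x y r
    using inner_product_on_commute[OF g] inner_product_on_scale[OF g] that sym_forms_scale by metis+
  note prods = diamond_frame frame.diamond_frame(2)[OF swap23] frame.diamond_frame(2)[OF rotate]
  show "g (a \<odot> a) (b \<odot> b) = 0"
    using met[of "a \<odot> a" "a \<odot> a" "b \<odot> b"] met[of "a \<odot> a" "a \<odot> a" "c \<odot> c"]
    by (simp add: prods scale)
  have "g (diamond (b \<odot> b) (c \<odot> c)) (a \<odot> a) = g (b \<odot> b) (diamond (a \<odot> a) (c \<odot> c))"
    using met[of "b \<odot> b" "c \<odot> c" "a \<odot> a"] by (simp add: diamond_commute)
  then show "g (a \<odot> a) (a \<odot> a) = g (b \<odot> b) (b \<odot> b)"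
    by (simp add: prods scale)
  have "ap2 (a \<odot> a) a a \<noteq> 0"
    by (simp add: sym_tensor_apply inner_frame)
  then have "a \<odot> a \<noteq> 0"
    by force
  then show "g (a \<odot> a) (a \<odot> a) > 0"
    by (intro inner_product_on_pos[OF g]) simp_all
qed

text \<open>The common \<open>g\<close> forces \<open>m\<close> to be a nonzero multiple of
  \<open>diamond\<close>; a rescaling then turns proportional multiplications into isomorphic
  ones.\<close>

theorem characterizing_conditions_unique:
  fixes g :: "'v::euclidean_space form2 \<Rightarrow> 'v form2 \<Rightarrow> real"
  assumes dim: "DIM('v) = 3" and d: "characterizing_conditions g diamond"
    and alg: "commutative_algebra sym_forms m" and m: "characterizing_conditions g m"
  obtains f :: "'v form2 \<Rightarrow> 'v form2" where "algebra_isomorphism sym_forms m sym_forms diamond f"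
proof -
  have inv: "\<And>f. orthogonal_transformation f \<Longrightarrow> algebra_isomorphism sym_forms m sym_forms m (orth_act f)"
    and g: "inner_product_on sym_forms g" and met: "metrized_by sym_forms m g"
    and ex: "\<exists>e\<in>sym_forms. m e e = e \<and> form_rank e = 1"
    and mult: "\<And>e. e \<in> sym_forms \<Longrightarrow> m e e = e \<Longrightarrow> form_rank e = 1 \<Longrightarrow>
      multiplicity_on sym_forms (m e) (1/2) = 3"
    using m unfolding characterizing_conditions_def by (elim conjE, simp)+
  have met_d: "metrized_by sym_forms diamond g"
    using d unfolding characterizing_conditions_def by (elim conjE)
  interpret invariant_algebra m
    by unfold_locales (use dim alg inv in auto)
  obtain A B C D where sq: "\<And>a b c. frame a b c \<Longrightarrow> m (a \<odot> a) (a \<odot> a) = A *\<^sub>R (a \<odot> a) + C *\<^sub>R (b \<odot> b + c \<odot> c)"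
    and pr: "\<And>a b c. frame a b c \<Longrightarrow> m (a \<odot> a) (b \<odot> b) = B *\<^sub>R (a \<odot> a + b \<odot> b) + D *\<^sub>R (c \<odot> c)"
    using structure_constants by blast
  obtain e where e: "e \<in> sym_forms" "m e e = e" "form_rank e = 1"
    using ex by blast
  obtain a b c r where f: "frame a b c" and r: "r \<noteq> 0" "e = r *\<^sub>R (a \<odot> a)"
    using form_rank_oneE[OF dim e(1,3)] .
  interpret frame a b c by fact
  have "(r * r) *\<^sub>R (A *\<^sub>R (a \<odot> a) + C *\<^sub>R (b \<odot> b + c \<odot> c)) = r *\<^sub>R (a \<odot> a)"
    using e(2) r(2) sq[OF f] by (simp add: m_scale m_scale_right sym_forms_closed)
  \<comment> \<open>Compare the aa and bb entries.\<close>
  from arg_cong[OF this, of "\<lambda>\<alpha>. ap2 \<alpha> a a"] arg_cong[OF this, of "\<lambda>\<alpha>. ap2 \<alpha> b b"]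
  have rA: "r * A = 1" and C: "C = 0"
    using r(1) by (simp_all add: blinfun.bilinear_simps sym_tensor_apply inner_frame)
  have "g (m (a \<odot> a) (a \<odot> a)) (b \<odot> b) = g (a \<odot> a) (m (a \<odot> a) (b \<odot> b))"
    using met by (simp add: metrized_by_def)
  also have "g (a \<odot> a) (m (a \<odot> a) (b \<odot> b)) = g (m (a \<odot> a) (b \<odot> b)) (a \<odot> a)"
    by (intro inner_product_on_commute[OF g]) (simp_all add: m_closed)
  finally have "g (A *\<^sub>R (a \<odot> a)) (b \<odot> b) = g (B *\<^sub>R (a \<odot> a + b \<odot> b) + D *\<^sub>R (c \<odot> c)) (a \<odot> a)"
    by (simp only: sq[OF f] pr[OF f] C scaleR_zero_left add_0_right)
  then have "A * g (a \<odot> a) (b \<odot> b) =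
      B * (g (a \<odot> a) (a \<odot> a) + g (b \<odot> b) (a \<odot> a)) + D * g (c \<odot> c) (a \<odot> a)"
    by (simp add: inner_product_on_add[OF g] inner_product_on_scale[OF g] sym_forms_closed)
  \<comment> \<open>Distinct squares are orthogonal for \<open>g\<close>, which leaves B g(aa, aa) =
    0.\<close>
  then have B: "B = 0"
    using diamond_metrizing_form[OF f g met_d] diamond_metrizing_form(1)[OF swap12 g met_d]
      diamond_metrizing_form(1)[OF frame.rotate[OF rotate] g met_d]
    by simp
  have comb: "m \<alpha> \<beta> = (A - 2 * D) *\<^sub>R sym_product \<alpha> \<beta> + (4 * D) *\<^sub>R diamond \<alpha> \<beta>"
    if "\<alpha> \<in> sym_forms" "\<beta> \<in> sym_forms" for \<alpha> \<beta>
    using sq pr B C that by (intro eq_combination) auto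
  \<comment> \<open>Multiplication by \<open>e\<close> is the operator \<open>T\<close> of the
    spectral lemmas with \<rho> = r D, and condition (6) selects its value.\<close>
  have "r * D = 1/2"
  proof (rule multiplicity_half_eq_3_imp[of "m e" "r * D"])
    fix \<alpha> :: "'v form2" assume \<alpha>: "\<alpha> \<in> sym_forms"
    note simps = r(2) comb[OF e(1) \<alpha>, unfolded r(2)] \<alpha> sym_forms_closed diamond_coords sym_product_eq
      blinfun.bilinear_simps sym_tensor_apply inner_frame sym_formsD[OF \<alpha>, of b a]
      sym_formsD[OF \<alpha>, of c a] sym_formsD[OF \<alpha>, of c b]
    have A: "A = 1 / r"
      using rA r(1) by (simp add: field_simps)
    show "m e \<alpha> \<in> sym_forms"
      using e(1) \<alpha> by (rule m_closed)
    show "ap2 (m e \<alpha>) a a = ap2 \<alpha> a a" "ap2 (m e \<alpha>) b b = r * D * ap2 \<alpha> c c"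
      "ap2 (m e \<alpha>) c c = r * D * ap2 \<alpha> b b" "ap2 (m e \<alpha>) a b = ap2 \<alpha> a b / 2"
      "ap2 (m e \<alpha>) a c = ap2 \<alpha> a c / 2" "ap2 (m e \<alpha>) b c = - (r * D) * ap2 \<alpha> b c"
      using r(1) by (simp_all add: simps A field_simps)
  qed (rule mult[OF e])
  then have "r * A = r * (2 * D)" "D \<noteq> 0"
    using rA by auto
  then have "A = 2 * D"
    using r(1) by (metis mult_cancel_left)
  then have m_eq: "m \<alpha> \<beta> = (4 * D) *\<^sub>R diamond \<alpha> \<beta>" if "\<alpha> \<in> sym_forms" "\<beta> \<in> sym_forms" for \<alpha> \<beta>
    using comb[OF that] \<open>A = 2 * D\<close> by simp
  have "bij_betw ((*\<^sub>R) (4 * D)) sym_forms (sym_forms :: 'v form2 set)"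
    using \<open>D \<noteq> 0\<close>
    by (intro bij_betw_byWitness[where f' = "(*\<^sub>R) (1 / (4 * D))"]) (auto simp: sym_forms_closed)
  \<comment> \<open>Scaling by 4 D is multiplicative since 4 D m(\<alpha>, \<beta>) = (4 D \<alpha>)
    \<diamond> (4 D \<beta>).\<close>
  then have "algebra_isomorphism sym_forms m sym_forms diamond ((*\<^sub>R) (4 * D))"
    by (simp add: algebra_isomorphism_def m_eq diamond_scale linear_scale[OF linear_diamond]
        scaleR_add_right)
  then show ?thesis
    by (rule that)
qed

section \<open>Automorphisms\<close>

locale diamond_automorphism =
  fixes f :: "'v::euclidean_space form2 \<Rightarrow> 'v form2"
  assumes dim: "DIM('v) = 3"
    and automorphism: "algebra_isomorphism sym_forms diamond sym_forms diamond f"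
begin

lemma f_add: "\<alpha> \<in> sym_forms \<Longrightarrow> \<beta> \<in> sym_forms \<Longrightarrow> f (\<alpha> + \<beta>) = f \<alpha> + f \<beta>"
  and f_scale: "\<alpha> \<in> sym_forms \<Longrightarrow> f (r *\<^sub>R \<alpha>) = r *\<^sub>R f \<alpha>"
  and f_diamond: "\<alpha> \<in> sym_forms \<Longrightarrow> \<beta> \<in> sym_forms \<Longrightarrow> f (diamond \<alpha> \<beta>) = diamond (f \<alpha>) (f \<beta>)"
  and f_bij: "bij_betw f sym_forms sym_forms"
  using automorphism by (auto simp: algebra_isomorphism_def)

lemma f_closed: "\<alpha> \<in> sym_forms \<Longrightarrow> f \<alpha> \<in> sym_forms"
  using f_bij by (auto simp: bij_betw_def)

lemma f_inj: "\<alpha> \<in> sym_forms \<Longrightarrow> \<beta> \<in> sym_forms \<Longrightarrow> f \<alpha> = f \<beta> \<longleftrightarrow> \<alpha> = \<beta>"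
  using f_bij by (auto simp: bij_betw_def inj_on_def)

lemma f_0: "f 0 = 0"
  using f_scale[of 0 0] by simp

lemma f_nonzero: "\<alpha> \<in> sym_forms \<Longrightarrow> \<alpha> \<noteq> 0 \<Longrightarrow> f \<alpha> \<noteq> 0"
  using f_inj[of \<alpha> 0] by (simp add: f_0)

text \<open>The eigenvalue \<open>1/4\<close> of \<^term>\<open>diamond hform\<close> tells \<^term>\<open>hform\<close> apart from the rank one idempotents.\<close>

lemma f_hform: "f hform = hform"
proof (rule ccontr)
  assume ne: "f hform \<noteq> hform"
  obtain a b c :: 'v where "frame a b c"
    using exists_frame_Basis[OF dim] .
  then interpret frame a b c .
  have h: "diamond hform hform = (hform :: 'v form2)"
    by (rule form_eqI) (simp_all add: diamond_in_sym_forms diamond_coords hform_coords)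
  have "ap2 hform a a \<noteq> 0" "ap2 (a \<odot> b) a b \<noteq> 0"
    by (simp_all add: hform_coords sym_tensor_apply inner_frame)
  then have nz: "hform \<noteq> (0 :: 'v form2)" "a \<odot> b \<noteq> 0"
    by force+
  have "diamond (f hform) (f hform) = f hform"
    using f_diamond[of hform hform] h by simp
  then obtain a' b' c' where "frame a' b' c'" "f hform = 2 *\<^sub>R (a' \<odot> a')"
    using diamond_idempotent[OF dim f_closed _ f_nonzero ne] nz by auto
  then have "spectrum_on sym_forms (diamond (f hform)) = {1, 1/2, -1/2}"
    by (simp add: frame.diamond_idempotent_spectrum)
  \<comment> \<open>\<open>a \<odot> b\<close> is trace-free, hence an eigenvector of multiplication
    by \<open>hform\<close> for 1/4, and \<open>f\<close> carries the eigenvalue along.\<close>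
  moreover have "diamond (f hform) (f (a \<odot> b)) = (1/4) *\<^sub>R f (a \<odot> b)"
    using f_diamond[of hform "a \<odot> b"]
    by (simp add: diamond_hform form_tr_eq sym_tensor_apply inner_frame f_scale)
  then have "1/4 \<in> spectrum_on sym_forms (diamond (f hform))"
    using f_closed[of "a \<odot> b"] f_nonzero[of "a \<odot> b"] nz(2) by (auto simp: spectrum_on_def)
  ultimately show False
    by simp
qed

lemma form_tr_f:
  assumes \<alpha>: "\<alpha> \<in> sym_forms"
  shows "form_tr (f \<alpha>) = form_tr \<alpha>"
proof -
  obtain a b c :: 'v where "frame a b c"
    using exists_frame_Basis[OF dim] .
  then interpret frame a b c .
  have "(1/4) *\<^sub>R (f \<alpha> + form_tr \<alpha> *\<^sub>R hform) = (1/4) *\<^sub>R (f \<alpha> + form_tr (f \<alpha>) *\<^sub>R hform)"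
    using f_diamond[of hform \<alpha>] \<alpha> f_closed[OF \<alpha>]
    by (simp add: f_hform diamond_hform f_scale f_add sym_forms_closed)
  from arg_cong[OF this, of "\<lambda>\<beta>. ap2 \<beta> a a"] show ?thesis
    by (simp add: blinfun.bilinear_simps hform_coords)
qed

lemma form_inner_f:
  assumes "\<alpha> \<in> sym_forms" "\<beta> \<in> sym_forms"
  shows "form_inner (f \<alpha>) (f \<beta>) = form_inner \<alpha> \<beta>"
proof -
  obtain a b c :: 'v where "frame a b c"
    using exists_frame_Basis[OF dim] .
  then interpret frame a b c .
  have "form_tr (diamond (f \<alpha>) (f \<beta>)) = form_tr (diamond \<alpha> \<beta>)"
    using assms by (metis diamond_in_sym_forms f_diamond form_tr_f)
  then show ?thesis
    using assms by (simp add: form_tr_diamond f_closed form_tr_f)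
qed

text \<open>The idempotent \<open>2 *\<^sub>R (a \<odot> a)\<close> goes to an idempotent which
  injectivity keeps away from 0 and \<open>hform\<close>, so the classification applies to the
  image.\<close>

lemma f_square:
  assumes "a \<bullet> a = 1"
  obtains a' where "a' \<bullet> a' = 1" "f (a \<odot> a) = a' \<odot> a'"
proof -
  obtain b c where "frame a b c"
    using frame_of_unit[OF dim assms] .
  then interpret frame a b c .
  let ?e = "2 *\<^sub>R (a \<odot> a)"
  have "ap2 ?e a a \<noteq> 0" "ap2 ?e b b \<noteq> ap2 hform b b"
    by (simp_all add: blinfun.bilinear_simps hform_coords sym_tensor_apply inner_frame)
  then have ne: "?e \<noteq> 0" "?e \<noteq> hform"
    by force+
  have e: "?e \<in> sym_forms"
    by (intro sym_forms_scale) simp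
  have "diamond ?e ?e = ?e"
    using diamond_frame(1) by (simp add: diamond_scale diamond_commute[of "a \<odot> a" ?e])
  then have "diamond (f ?e) (f ?e) = f ?e"
    using f_diamond[OF e e] by simp
  moreover have "f ?e \<noteq> hform"
    using f_inj[OF e hform_in_sym_forms] ne by (simp add: f_hform)
  ultimately obtain a' b' c' where "frame a' b' c'" "f ?e = 2 *\<^sub>R (a' \<odot> a')"
    using diamond_idempotent[OF dim f_closed[OF e] _ f_nonzero[OF e ne(1)]] by metis
  then show ?thesis
    using that[of a'] by (simp add: f_scale frame.unit)
qed

text \<open>\<open>form_inner\<close> of two squares is the square of the inner product of the
  vectors, so its invariance makes the image vectors orthogonal.\<close>

lemma f_frame:
  assumes "frame a b c"
  obtains a' b' c' where "frame a' b' c'" "f (a \<odot> a) = a' \<odot> a'" "f (b \<odot> b) = b' \<odot> b'" "f (c \<odot> c) = c' \<odot> c'"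
proof -
  interpret frame a b c by fact
  obtain a' b' c' where unit': "a' \<bullet> a' = 1" "b' \<bullet> b' = 1" "c' \<bullet> c' = 1"
    and f: "f (a \<odot> a) = a' \<odot> a'" "f (b \<odot> b) = b' \<odot> b'" "f (c \<odot> c) = c' \<odot> c'"
    using f_square unit by metis
  have inner: "form_inner (u \<odot> u) (v \<odot> v) = (u \<bullet> v)\<^sup>2" for u v :: 'v
  proof -
    have "u \<bullet> v = (u \<bullet> a) * (v \<bullet> a) + (u \<bullet> b) * (v \<bullet> b) + (u \<bullet> c) * (v \<bullet> c)"
      by (rule inner_eq)
    then show ?thesis
      by (simp add: form_inner_eq sym_tensor_apply power2_eq_square algebra_simps)
  qed
  have "(a' \<bullet> b')\<^sup>2 = (a \<bullet> b)\<^sup>2" "(a' \<bullet> c')\<^sup>2 = (a \<bullet> c)\<^sup>2" "(b' \<bullet> c')\<^sup>2 = (b \<bullet> c)\<^sup>2"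
    using form_inner_f[of "a \<odot> a" "b \<odot> b"] form_inner_f[of "a \<odot> a" "c \<odot> c"]
      form_inner_f[of "b \<odot> b" "c \<odot> c"] by (simp_all only: f inner sym_tensor_in_sym_forms)
  then have "frame a' b' c'"
    using unit' dim by unfold_locales (simp_all add: orth)
  then show ?thesis
    using f by (rule that)
qed

text \<open>bc lies in the -1/2 eigenspace of multiplication by 2 aa, spanned by bb - cc and bc. Its
  image lies in the corresponding eigenspace of the new frame; orthogonality to the image of bb
  removes the first direction, and the norm fixes the remaining coefficient up to sign.\<close>

lemma f_mixed:
  assumes F: "frame a b c" "frame a' b' c'"
    and f: "f (a \<odot> a) = a' \<odot> a'" "f (b \<odot> b) = b' \<odot> b'" "f (c \<odot> c) = c' \<odot> c'"
  obtains \<epsilon> where "\<epsilon> * \<epsilon> = 1" "f (b \<odot> c) = \<epsilon> *\<^sub>R (b' \<odot> c')"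
proof -
  interpret frame a b c by fact
  interpret F': frame a' b' c' by fact
  let ?\<beta> = "f (b \<odot> c)"
  have \<beta>: "?\<beta> \<in> sym_forms"
    by (simp add: f_closed)
  have "diamond (2 *\<^sub>R (a \<odot> a)) (b \<odot> c) = (-1/2) *\<^sub>R (b \<odot> c)"
    by (subst eigen_iff[OF diamond_idempotent_closed diamond_idempotent_coords])
       (simp_all add: eigen_coords_def sym_tensor_apply inner_frame)
  then have "diamond (2 *\<^sub>R (a' \<odot> a')) ?\<beta> = (-1/2) *\<^sub>R ?\<beta>"
    using f_diamond[of "2 *\<^sub>R (a \<odot> a)" "b \<odot> c"] f_scale[of "a \<odot> a" 2] f_scale[of "b \<odot> c" "-1/2"]
    by (simp add: f(1) sym_forms_closed)
  then have "F'.eigen_coords (1/2) (-1/2) ?\<beta>"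
    using F'.eigen_iff[OF F'.diamond_idempotent_closed F'.diamond_idempotent_coords \<beta>] by metis
  then have zero: "ap2 ?\<beta> a' a' = 0" "ap2 ?\<beta> a' b' = 0" "ap2 ?\<beta> a' c' = 0"
    and "ap2 ?\<beta> c' c' = - ap2 ?\<beta> b' b'"
    unfolding F'.eigen_coords_def by linarith+
  moreover have "form_inner (b \<odot> c) (b \<odot> b) = 0"
    by (simp add: form_inner_eq sym_tensor_apply inner_frame)
  then have "form_inner ?\<beta> (b' \<odot> b') = 0"
    using form_inner_f[of "b \<odot> c" "b \<odot> b"] by (simp add: f(2))
  then have "ap2 ?\<beta> b' b' = 0"
    by (simp add: F'.form_inner_eq \<beta> sym_tensor_apply F'.inner_frame)
  ultimately have eq: "?\<beta> = (2 * ap2 ?\<beta> b' c') *\<^sub>R (b' \<odot> c')"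
    using F'.sym_form_eq[OF \<beta>] by simp
  have "form_inner ?\<beta> ?\<beta> = form_inner (b \<odot> c) (b \<odot> c)"
    by (intro form_inner_f) simp_all
  also have "form_inner ?\<beta> ?\<beta> = 2 * (ap2 ?\<beta> b' c' * ap2 ?\<beta> b' c')"
    using zero \<open>ap2 ?\<beta> b' b' = 0\<close> \<open>ap2 ?\<beta> c' c' = - ap2 ?\<beta> b' b'\<close> by (simp add: F'.form_inner_eq \<beta>)
  \<comment> \<open>The squared norm of \<open>b \<odot> c\<close> is 1/2.\<close>
  finally have "(2 * ap2 ?\<beta> b' c') * (2 * ap2 ?\<beta> b' c') = 1"
    by (simp add: form_inner_eq sym_tensor_apply inner_frame)
  then show ?thesis
    using eq by (rule that)
qed

theorem f_eq_orth_act: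
  obtains g where "orthogonal_transformation g" "\<And>\<alpha>. \<alpha> \<in> sym_forms \<Longrightarrow> f \<alpha> = orth_act g \<alpha>"
proof -
  obtain a b c :: 'v where F: "frame a b c"
    using exists_frame_Basis[OF dim] .
  interpret frame a b c by fact
  obtain a' b' c' where F': "frame a' b' c'"
    and f: "f (a \<odot> a) = a' \<odot> a'" "f (b \<odot> b) = b' \<odot> b'" "f (c \<odot> c) = c' \<odot> c'"
    using f_frame[OF F] .
  interpret F': frame a' b' c' by fact
  obtain r where r: "r * r = 1" "f (b \<odot> c) = r *\<^sub>R (b' \<odot> c')"
    using f_mixed[OF F F' f] .
  obtain s where s: "s * s = 1" "f (c \<odot> a) = s *\<^sub>R (c' \<odot> a')"
    using f_mixed[OF rotate F'.rotate f(2,3,1)] .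
  obtain t where t: "t * t = 1" "f (a \<odot> b) = t *\<^sub>R (a' \<odot> b')"
    using f_mixed[OF frame.rotate[OF rotate] frame.rotate[OF F'.rotate] f(3,1,2)] .
  \<comment> \<open>This product relation ties the three signs together: it forces s = t r.\<close>
  have prod: "diamond (x \<odot> y) (y \<odot> z) = (1/4) *\<^sub>R (z \<odot> x)" if "frame x y z" for x y z :: 'v
  proof -
    interpret F'': frame x y z by fact
    show ?thesis
      by (rule F''.form_eqI) (simp_all add: diamond_in_sym_forms sym_forms_closed F''.diamond_coords
          blinfun.bilinear_simps sym_tensor_apply F''.inner_frame)
  qed
  have "(1/4) *\<^sub>R (s *\<^sub>R (c' \<odot> a')) = f (diamond (a \<odot> b) (b \<odot> c))"
    by (simp add: prod[OF F] f_scale s)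
  also have "\<dots> = diamond (t *\<^sub>R (a' \<odot> b')) (r *\<^sub>R (b' \<odot> c'))"
    by (simp add: f_diamond r t)
  also have "\<dots> = (t * r) *\<^sub>R diamond (a' \<odot> b') (b' \<odot> c')"
    by (simp add: diamond_scale diamond_commute[of "a' \<odot> b'"])
  also have "\<dots> = (t * r) *\<^sub>R (1/4) *\<^sub>R (c' \<odot> a')"
    by (simp add: prod[OF F'])
  finally have "ap2 ((1/4) *\<^sub>R (s *\<^sub>R (c' \<odot> a'))) c' a' = ap2 ((t * r) *\<^sub>R (1/4) *\<^sub>R (c' \<odot> a')) c' a'"
    by (simp only:)
  then have s_eq: "s = t * r"
    by (simp add: blinfun.bilinear_simps sym_tensor_apply F'.inner_frame)
  \<comment> \<open>Scaling the image frame by r, s, t leaves its squares unchanged and multiplies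
    the mixed products by s t = r, r t = s and r s = t, which are the signs prescribed by
    \<open>f\<close>.\<close>
  obtain g where g: "orthogonal_transformation g" "g a = r *\<^sub>R a'" "g b = s *\<^sub>R b'" "g c = t *\<^sub>R c'"
    using transformation_to_frame[OF F'.scale_frame[OF r(1) s(1) t(1)]] .
  have signs: "s * t = r" "t * r = s" "r * s = t"
    using r(1) t(1) s_eq by algebra+
  have basis: "f (a \<odot> a) = orth_act g (a \<odot> a)" "f (b \<odot> b) = orth_act g (b \<odot> b)" "f (c \<odot> c) = orth_act g (c \<odot> c)"
    "f (b \<odot> c) = orth_act g (b \<odot> c)" "f (a \<odot> c) = orth_act g (a \<odot> c)" "f (a \<odot> b) = orth_act g (a \<odot> b)"
    by (simp_all only: orth_act_sym_tensor[OF g(1)] g sym_tensor_scale r s t f scaleR_one signs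
        sym_tensor_commute[of a c] sym_tensor_commute[of "r *\<^sub>R a'" "t *\<^sub>R c'"])
  have "f \<alpha> = orth_act g \<alpha>" if \<alpha>: "\<alpha> \<in> sym_forms" for \<alpha>
    using orth_act_linear[OF g(1)]
    by (subst (1 2) sym_form_eq[OF \<alpha>]) (simp add: f_add f_scale sym_forms_closed basis linear_add linear_scale)
  with g(1) show ?thesis
    by (rule that)
qed

end

section \<open>Metric curvature tensors\<close>

lemma form4_eqI: "(\<And>i j k l. ap4 X i j k l = ap4 Y i j k l) \<Longrightarrow> X = Y"
  by (intro blinfun_eqI)

text \<open>Antisymmetry in the first two indices makes the six-term alternation twice the cyclic
  sum, which is the usual Bianchi identity.\<close>

lemma curvature_tensors_iff:
  "Y \<in> curvature_tensors \<longleftrightarrow>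
     (\<forall>i j k l. ap4 Y j i k l = - ap4 Y i j k l) \<and>
     (\<forall>i j k l. ap4 Y i j l k = - ap4 Y i j k l) \<and>
     (\<forall>i j k l. ap4 Y i j k l + ap4 Y j k i l + ap4 Y k i j l = 0)"
proof -
  have "(1/2) * (u - v) = u \<longleftrightarrow> v = - u" for u v :: real
    by auto
  then have antisym: "(\<forall>i j k l. (1/2) * (ap4 Y i j k l - ap4 Y j i k l) = ap4 Y i j k l) \<longleftrightarrow>
      (\<forall>i j k l. ap4 Y j i k l = - ap4 Y i j k l)"
    "(\<forall>i j k l. (1/2) * (ap4 Y i j k l - ap4 Y i j l k) = ap4 Y i j k l) \<longleftrightarrow>
      (\<forall>i j k l. ap4 Y i j l k = - ap4 Y i j k l)"
    by blast+
  have "(1/6) * (ap4 Y i j k l + ap4 Y j k i l + ap4 Y k i j l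
          - ap4 Y j i k l - ap4 Y i k j l - ap4 Y k j i l) = 0 \<longleftrightarrow>
        ap4 Y i j k l + ap4 Y j k i l + ap4 Y k i j l = 0"
    if s: "\<forall>i j k l. ap4 Y j i k l = - ap4 Y i j k l" for i j k l
    using s[rule_format, of j i k l] s[rule_format, of i k j l] s[rule_format, of k j i l] by auto
  then show ?thesis
    unfolding curvature_tensors_def mem_Collect_eq antisym by blast
qed

lemma curvature_tensorsD:
  assumes "Y \<in> curvature_tensors"
  shows "ap4 Y j i k l = - ap4 Y i j k l" "ap4 Y i j l k = - ap4 Y i j k l"
    and curvature_bianchi: "ap4 Y i j k l + ap4 Y j k i l + ap4 Y k i j l = 0"
  using assms unfolding curvature_tensors_iff by blast+

text \<open>The classical octahedron argument: the Bianchi identities for the four rotations of the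
  indices, with antisymmetry in both pairs, combine to twice the claim.\<close>

lemma curvature_pair_symmetry:
  assumes "Y \<in> curvature_tensors"
  shows "ap4 Y i j k l = ap4 Y k l i j"
proof -
  note B = curvature_bianchi[OF assms] and s1 = curvature_tensorsD(1)[OF assms]
    and s2 = curvature_tensorsD(2)[OF assms]
  show ?thesis
    using B[of i j k l] B[of j k l i] B[of k l i j] B[of l i j k]
      s2[of j k l i] s2[of k l j i] s1[of l j k i] s1[of l i k j] s2[of i l k j]
      s1[of i k l j] s2[of k i l j] s1[of l i j k] s2[of i j l k] s2[of j l i k]
    by linarith
qed

lemma subspace_curvature_tensors: "subspace curvature_tensors"
  unfolding subspace_def
proof (intro conjI ballI allI)
  fix X Y :: "'a form4" and r :: real
  assume X: "X \<in> curvature_tensors" and Y: "Y \<in> curvature_tensors"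
  show "X + Y \<in> curvature_tensors"
    unfolding curvature_tensors_iff
  proof (intro conjI allI)
    fix i j k l :: 'a
    show "ap4 (X + Y) i j k l + ap4 (X + Y) j k i l + ap4 (X + Y) k i j l = 0"
      using curvature_bianchi[OF X, of i j k l] curvature_bianchi[OF Y, of i j k l]
      by (simp add: blinfun.bilinear_simps)
    show "ap4 (X + Y) j i k l = - ap4 (X + Y) i j k l"
      using curvature_tensorsD(1)[OF X, of j i k l] curvature_tensorsD(1)[OF Y, of j i k l]
      by (simp add: blinfun.bilinear_simps)
    show "ap4 (X + Y) i j l k = - ap4 (X + Y) i j k l"
      using curvature_tensorsD(2)[OF X, of i j l k] curvature_tensorsD(2)[OF Y, of i j l k]
      by (simp add: blinfun.bilinear_simps)
  qed
next
  fix X :: "'a form4" and r :: real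
  assume X: "X \<in> curvature_tensors"
  show "r *\<^sub>R X \<in> curvature_tensors"
    unfolding curvature_tensors_iff
  proof (intro conjI allI)
    fix i j k l :: 'a
    show "ap4 (r *\<^sub>R X) j i k l = - ap4 (r *\<^sub>R X) i j k l"
      using curvature_tensorsD(1)[OF X, of j i k l] by (simp add: blinfun.bilinear_simps)
    show "ap4 (r *\<^sub>R X) i j l k = - ap4 (r *\<^sub>R X) i j k l"
      using curvature_tensorsD(2)[OF X, of i j l k] by (simp add: blinfun.bilinear_simps)
    have "r * (ap4 X i j k l + ap4 X j k i l + ap4 X k i j l) = 0"
      using curvature_bianchi[OF X, of i j k l] by simp
    then show "ap4 (r *\<^sub>R X) i j k l + ap4 (r *\<^sub>R X) j k i l + ap4 (r *\<^sub>R X) k i j l = 0"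
      by (simp add: blinfun.bilinear_simps distrib_left)
  qed
qed (simp add: curvature_tensors_iff)

text \<open>The summand of the hat operator on fourth-order tensors, with all twelve ordered pairs
  of positions written out. For fixed \<open>p\<close> and \<open>q\<close> the symmetries of the
  product can be checked before summation.\<close>

definition hat_term :: "'v::euclidean_space form4 \<Rightarrow> 'v form4 \<Rightarrow> 'v \<Rightarrow> 'v \<Rightarrow> 'v \<Rightarrow> 'v \<Rightarrow> 'v \<Rightarrow> 'v \<Rightarrow> real" where
  "hat_term X Y p q i j k l =
     ap4 X p i j q * ap4 Y p q k l + ap4 X p j i q * ap4 Y q p k l +
     ap4 X p i k q * ap4 Y p j q l + ap4 X p k i q * ap4 Y q j p l +
     ap4 X p i l q * ap4 Y p j k q + ap4 X p l i q * ap4 Y q j k p +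
     ap4 X p j k q * ap4 Y i p q l + ap4 X p k j q * ap4 Y i q p l +
     ap4 X p j l q * ap4 Y i p k q + ap4 X p l j q * ap4 Y i q k p +
     ap4 X p k l q * ap4 Y i j p q + ap4 X p l k q * ap4 Y i j q p"

lemma curv_hat_eq:
  "curv_hat X (\<lambda>xs. ap4 Y (xs ! 0) (xs ! 1) (xs ! 2) (xs ! 3)) [i, j, k, l] =
     (1/4) * (\<Sum>p\<in>Basis. \<Sum>q\<in>Basis. hat_term X Y p q i j k l)"
proof -
  have "{..<length [i, j, k, l]} = {0, 1, 2, 3}"
    by auto
  then show ?thesis
    by (simp add: curv_hat_def hat_term_def sum.distrib insert_Diff_if algebra_simps numeral_2_eq_2 numeral_3_eq_3)
qed

lemma curv_mult_apply:
  "ap4 (curv_mult X Y) i j k l = (1/4) * (\<Sum>p\<in>Basis. \<Sum>q\<in>Basis. hat_term X Y p q i j k l)"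
proof -
  have add: "hat_term X Y p q (i + i') j k l = hat_term X Y p q i j k l + hat_term X Y p q i' j k l"
    "hat_term X Y p q i (j + i') k l = hat_term X Y p q i j k l + hat_term X Y p q i i' k l"
    "hat_term X Y p q i j (k + i') l = hat_term X Y p q i j k l + hat_term X Y p q i j i' l"
    "hat_term X Y p q i j k (l + i') = hat_term X Y p q i j k l + hat_term X Y p q i j k i'"
    for p q i j k l i'
    by (simp_all add: hat_term_def blinfun.bilinear_simps algebra_simps)
  have scale: "hat_term X Y p q (r *\<^sub>R i) j k l = r * hat_term X Y p q i j k l"
    "hat_term X Y p q i (r *\<^sub>R j) k l = r * hat_term X Y p q i j k l"
    "hat_term X Y p q i j (r *\<^sub>R k) l = r * hat_term X Y p q i j k l"
    "hat_term X Y p q i j k (r *\<^sub>R l) = r * hat_term X Y p q i j k l"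
    for p q i j k l r
    by (simp_all add: hat_term_def blinfun.bilinear_simps algebra_simps)
  show ?thesis
    unfolding curv_mult_def curv_hat_eq
    by (subst mk4_apply)
       (simp_all add: linear_iff add scale sum.distrib add_divide_distrib flip: sum_distrib_left)
qed

lemma curv_mult_add: "curv_mult (X + X') Y = curv_mult X Y + curv_mult X' Y"
proof (rule form4_eqI)
  have "hat_term (X + X') Y p q i j k l = hat_term X Y p q i j k l + hat_term X' Y p q i j k l" for p q i j k l
    by (simp add: hat_term_def blinfun.bilinear_simps algebra_simps)
  then show "ap4 (curv_mult (X + X') Y) i j k l = ap4 (curv_mult X Y + curv_mult X' Y) i j k l" for i j k l
    by (simp add: curv_mult_apply blinfun.bilinear_simps sum.distrib add_divide_distrib)
qed

lemma curv_mult_scale: "curv_mult (r *\<^sub>R X) Y = r *\<^sub>R curv_mult X Y"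
proof (rule form4_eqI)
  have "hat_term (r *\<^sub>R X) Y p q i j k l = r * hat_term X Y p q i j k l" for p q i j k l
    by (simp add: hat_term_def blinfun.bilinear_simps algebra_simps)
  then show "ap4 (curv_mult (r *\<^sub>R X) Y) i j k l = ap4 (r *\<^sub>R curv_mult X Y) i j k l" for i j k l
    by (simp add: curv_mult_apply blinfun.bilinear_simps sum_distrib_left)
qed

text \<open>The symmetries pass from \<open>Y\<close> to the summands of \<open>curv_mult X Y\<close> because the sum defining
  the hat operator runs over all ordered pairs of positions.\<close>

lemma curv_mult_in_curvature_tensors:
  assumes "Y \<in> curvature_tensors"
  shows "curv_mult X Y \<in> curvature_tensors"
proof -
  note s1 = curvature_tensorsD(1)[OF assms] and s2 = curvature_tensorsD(2)[OF assms]
  have B: "ap4 Y i j k l = - ap4 Y j k i l - ap4 Y k i j l" for i j k l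
    using curvature_bianchi[OF assms, of i j k l] by linarith
  have swap12: "hat_term X Y p q j i k l = - hat_term X Y p q i j k l" for p q i j k l
    unfolding hat_term_def s1[of q p] s1[of q j] s1[of p j] s1[of i j] s1[of i p] s1[of i q]
    by (simp add: algebra_simps)
  have swap34: "hat_term X Y p q i j l k = - hat_term X Y p q i j k l" for p q i j k l
    unfolding hat_term_def s2[of _ _ q p] s2[of _ _ l q] s2[of _ _ l p] s2[of _ _ l k] s2[of _ _ q k] s2[of _ _ p k]
    by (simp add: algebra_simps)
  \<comment> \<open>Collected by components of \<open>X\<close>, the cyclic sum falls into Bianchi
    sums of \<open>Y\<close>.\<close>
  have cyclic: "hat_term X Y p q i j k l + hat_term X Y p q j k i l + hat_term X Y p q k i j l = 0"
    for p q i j k l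
    unfolding hat_term_def
      B[of i p q l] B[of i q p l] B[of j p q l] B[of j q p l] B[of k p q l] B[of k q p l]
      B[of p j k q] B[of p k i q] B[of p i j q] B[of q j k p] B[of q k i p] B[of q i j p]
    by (simp add: algebra_simps)
  show ?thesis
    unfolding curvature_tensors_iff
  proof (intro conjI allI)
    fix i j k l
    show "ap4 (curv_mult X Y) j i k l = - ap4 (curv_mult X Y) i j k l"
      unfolding curv_mult_apply swap12[of _ _ j i k l] by (simp add: sum_negf)
    show "ap4 (curv_mult X Y) i j l k = - ap4 (curv_mult X Y) i j k l"
      unfolding curv_mult_apply swap34[of _ _ i j l k] by (simp add: sum_negf)
    have "(\<Sum>p\<in>Basis. \<Sum>q\<in>Basis. hat_term X Y p q i j k l + hat_term X Y p q j k i l + hat_term X Y p q k i j l) = 0"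
      by (simp only: cyclic sum.neutral_const)
    then show "ap4 (curv_mult X Y) i j k l + ap4 (curv_mult X Y) j k i l + ap4 (curv_mult X Y) k i j l = 0"
      unfolding curv_mult_apply sum.distrib by linarith
  qed
qed

section \<open>The map \<Psi> onto the curvature tensors\<close>

lemma curly_wedge_apply:
  "ap4 (curly_wedge \<alpha> \<beta>) i j k l =
      (1/2) * (ap2 \<alpha> k i * ap2 \<beta> j l - ap2 \<alpha> k j * ap2 \<beta> i l)
    - (1/2) * (ap2 \<alpha> l i * ap2 \<beta> j k - ap2 \<alpha> l j * ap2 \<beta> i k)"
  unfolding curly_wedge_def
  by (subst mk4_apply) (simp_all add: linear_iff blinfun.bilinear_simps algebra_simps add_divide_distrib diff_divide_distrib)

lemma Psi_apply:
  "ap4 (Psi \<alpha>) i j k l =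
      (1/2) * ((ap2 \<alpha> k i - form_tr \<alpha> / 2 * (k \<bullet> i)) * (j \<bullet> l) - (ap2 \<alpha> k j - form_tr \<alpha> / 2 * (k \<bullet> j)) * (i \<bullet> l))
    - (1/2) * ((ap2 \<alpha> l i - form_tr \<alpha> / 2 * (l \<bullet> i)) * (j \<bullet> k) - (ap2 \<alpha> l j - form_tr \<alpha> / 2 * (l \<bullet> j)) * (i \<bullet> k))"
  by (simp add: Psi_def curly_wedge_apply blinfun.bilinear_simps hform_apply)

lemma Psi_add: "Psi (\<alpha> + \<beta>) = Psi \<alpha> + Psi \<beta>"
  by (rule form4_eqI) (simp add: Psi_apply blinfun.bilinear_simps form_tr_add field_simps)

lemma Psi_scale: "Psi (r *\<^sub>R \<alpha>) = r *\<^sub>R Psi \<alpha>"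
  by (rule form4_eqI) (simp add: Psi_apply blinfun.bilinear_simps form_tr_scale field_simps)

text \<open>The trace-shifted form \<open>A\<close> is symmetric, as is the inner product; the
  curvature symmetries of the wedge are cancellations resting on this.\<close>

lemma Psi_in_curvature_tensors:
  assumes "\<alpha> \<in> sym_forms"
  shows "Psi \<alpha> \<in> curvature_tensors"
proof -
  define A where "A x y = ap2 \<alpha> x y - form_tr \<alpha> / 2 * (x \<bullet> y)" for x y
  have A: "A x y = A y x" for x y
    by (simp add: A_def inner_commute[of x y] sym_formsD[OF assms, of x y])
  have Psi: "ap4 (Psi \<alpha>) i j k l = (1/2) * (A k i * (j \<bullet> l) - A k j * (i \<bullet> l)) - (1/2) * (A l i * (j \<bullet> k) - A l j * (i \<bullet> k))"
    for i j k l
    by (simp add: Psi_apply A_def)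
  show ?thesis
    unfolding curvature_tensors_iff Psi
  proof (intro conjI allI)
    fix i j k l :: 'a
    show "(1/2) * (A k i * (j \<bullet> l) - A k j * (i \<bullet> l)) - (1/2) * (A l i * (j \<bullet> k) - A l j * (i \<bullet> k)) +
      ((1/2) * (A i j * (k \<bullet> l) - A i k * (j \<bullet> l)) - (1/2) * (A l j * (k \<bullet> i) - A l k * (j \<bullet> i))) +
      ((1/2) * (A j k * (i \<bullet> l) - A j i * (k \<bullet> l)) - (1/2) * (A l k * (i \<bullet> j) - A l i * (k \<bullet> j))) = 0"
      unfolding A[of k i] A[of k j] A[of j i] inner_commute[of k i] inner_commute[of k j] inner_commute[of j i]
      by (simp add: algebra_simps)
  qed (simp_all add: algebra_simps)
qed

context frame
begin

text \<open>Read as rewrite rules, these bring each frame component to one of six: in dimension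
  three a curvature tensor is a symmetric form on the planes ab, ac, bc.\<close>

lemma curvature_frame:
  fixes Y :: "'v form4"
  assumes "Y \<in> curvature_tensors"
  shows "ap4 Y u u k l = 0" "ap4 Y i j u u = 0"
    "ap4 Y b a k l = - ap4 Y a b k l" "ap4 Y c a k l = - ap4 Y a c k l" "ap4 Y c b k l = - ap4 Y b c k l"
    "ap4 Y i j b a = - ap4 Y i j a b" "ap4 Y i j c a = - ap4 Y i j a c" "ap4 Y i j c b = - ap4 Y i j b c"
    "ap4 Y a c a b = ap4 Y a b a c" "ap4 Y b c a b = ap4 Y a b b c" "ap4 Y b c a c = ap4 Y a c b c"
proof -
  show "ap4 Y u u k l = 0" "ap4 Y i j u u = 0"
    using curvature_tensorsD(1)[OF assms, of u u k l] curvature_tensorsD(2)[OF assms, of i j u u] by simp_all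
qed (rule curvature_tensorsD[OF assms] curvature_pair_symmetry[OF assms])+

lemma linear_eq_0:
  fixes f :: "'v \<Rightarrow> real"
  assumes "linear f" "f a = 0" "f b = 0" "f c = 0"
  shows "f x = 0"
proof -
  have "f x = f ((x \<bullet> a) *\<^sub>R a + (x \<bullet> b) *\<^sub>R b + (x \<bullet> c) *\<^sub>R c)"
    by (rule arg_cong[OF expand])
  also have "\<dots> = 0"
    using assms by (simp add: linear_add linear_scale)
  finally show ?thesis .
qed

text \<open>The difference vanishes on frame vectors, and multilinearity then frees one slot at a
  time, beginning with the last.\<close>

lemma curvature_eqI:
  fixes X Y :: "'v form4"
  assumes "X \<in> curvature_tensors" "Y \<in> curvature_tensors"
    and "ap4 X a b a b = ap4 Y a b a b" "ap4 X a c a c = ap4 Y a c a c" "ap4 X b c b c = ap4 Y b c b c"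
    and "ap4 X a b a c = ap4 Y a b a c" "ap4 X a b b c = ap4 Y a b b c" "ap4 X a c b c = ap4 Y a c b c"
  shows "X = Y"
proof -
  define Z where "Z = X - Y"
  have Z: "Z \<in> curvature_tensors"
    unfolding Z_def using assms(1,2) by (intro subspace_diff subspace_curvature_tensors)
  have zero: "ap4 Z a b a b = 0" "ap4 Z a c a c = 0" "ap4 Z b c b c = 0"
    "ap4 Z a b a c = 0" "ap4 Z a b b c = 0" "ap4 Z a c b c = 0"
    using assms by (simp_all add: Z_def blinfun.bilinear_simps)
  have base: "\<forall>i\<in>{a, b, c}. \<forall>j\<in>{a, b, c}. \<forall>k\<in>{a, b, c}. \<forall>l\<in>{a, b, c}. ap4 Z i j k l = 0"
    by (simp add: curvature_frame[OF Z] zero)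
  have l4: "ap4 Z i j k l = 0" if "i \<in> {a, b, c}" "j \<in> {a, b, c}" "k \<in> {a, b, c}" for i j k l
  proof (rule linear_eq_0[of "\<lambda>l. ap4 Z i j k l"])
    show "linear (\<lambda>l. ap4 Z i j k l)"
      by (simp add: linear_iff blinfun.bilinear_simps)
  qed (use base that in \<open>blast+\<close>)
  have l3: "ap4 Z i j k l = 0" if "i \<in> {a, b, c}" "j \<in> {a, b, c}" for i j k l
  proof (rule linear_eq_0[of "\<lambda>k. ap4 Z i j k l"])
    show "linear (\<lambda>k. ap4 Z i j k l)"
      by (simp add: linear_iff blinfun.bilinear_simps)
  qed (use l4 that in \<open>blast+\<close>)
  have l2: "ap4 Z i j k l = 0" if "i \<in> {a, b, c}" for i j k l
  proof (rule linear_eq_0[of "\<lambda>j. ap4 Z i j k l"])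
    show "linear (\<lambda>j. ap4 Z i j k l)"
      by (simp add: linear_iff blinfun.bilinear_simps)
  qed (use l3 that in \<open>blast+\<close>)
  have l1: "ap4 Z i j k l = 0" for i j k l
  proof (rule linear_eq_0[of "\<lambda>i. ap4 Z i j k l"])
    show "linear (\<lambda>i. ap4 Z i j k l)"
      by (simp add: linear_iff blinfun.bilinear_simps)
  qed (use l2 in \<open>blast+\<close>)
  have "Z = 0"
    by (intro form4_eqI) (simp add: l1)
  then show ?thesis
    by (simp add: Z_def)
qed

text \<open>The shift by half the trace makes a plane correspond to its normal: with A = \<alpha> -
  (tr \<alpha> / 2) h the first component is (A(a, a) + A(b, b)) / 2, and A(a, a) + A(b, b) =
  -\<alpha>(c, c).\<close>

lemma Psi_coords:
  fixes \<alpha> :: "'v form2"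
  assumes "\<alpha> \<in> sym_forms"
  shows "ap4 (Psi \<alpha>) a b a b = - ap2 \<alpha> c c / 2" "ap4 (Psi \<alpha>) a c a c = - ap2 \<alpha> b b / 2"
    "ap4 (Psi \<alpha>) b c b c = - ap2 \<alpha> a a / 2" "ap4 (Psi \<alpha>) a b a c = ap2 \<alpha> b c / 2"
    "ap4 (Psi \<alpha>) a b b c = - ap2 \<alpha> a c / 2" "ap4 (Psi \<alpha>) a c b c = ap2 \<alpha> a b / 2"
  by (simp_all add: Psi_apply inner_frame form_tr_eq sym_formsD[OF assms, of c b]
      sym_formsD[OF assms, of c a] sym_formsD[OF assms, of b a] field_simps)

text \<open>\<open>curv_mult\<close> contracts over \<open>Basis\<close>, so the frame is taken to
  be \<open>Basis\<close> itself. The double sum becomes explicit, and both sides are compared in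
  six components.\<close>

lemma Psi_diamond:
  fixes \<alpha> \<beta> :: "'v form2"
  assumes Basis: "Basis = {a, b, c}" and "\<alpha> \<in> sym_forms" "\<beta> \<in> sym_forms"
  shows "Psi (diamond \<alpha> \<beta>) = curv_mult (Psi \<alpha>) (Psi \<beta>)"
proof -
  note C = Psi_in_curvature_tensors
  note simps = Psi_coords assms(2,3) diamond_in_sym_forms diamond_coords curv_mult_apply Basis distinct_frame
    hat_term_def curvature_frame[OF C[OF assms(2)]] curvature_frame[OF C[OF assms(3)]]
  show ?thesis
    by (rule curvature_eqI)
       (simp_all add: C diamond_in_sym_forms assms(2,3) curv_mult_in_curvature_tensors, simp_all add: simps field_simps)
qed

lemma Psi_inj:
  fixes \<alpha> \<beta> :: "'v form2"
  assumes "\<alpha> \<in> sym_forms" "\<beta> \<in> sym_forms" "Psi \<alpha> = Psi \<beta>"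
  shows "\<alpha> = \<beta>"
  using Psi_coords[OF assms(1)] Psi_coords[OF assms(2)] assms by (intro form_eqI) auto

lemma Psi_surj:
  fixes Y :: "'v form4"
  assumes Y: "Y \<in> curvature_tensors"
  obtains \<alpha> where "\<alpha> \<in> sym_forms" "Psi \<alpha> = Y"
proof -
  \<comment> \<open>The inverse of \<open>Psi_coords\<close>; mixed coefficients double because
    \<open>a \<odot> b\<close> has ab entry 1/2.\<close>
  define \<alpha> where "\<alpha> = (-2 * ap4 Y b c b c) *\<^sub>R (a \<odot> a) + (-2 * ap4 Y a c a c) *\<^sub>R (b \<odot> b)
    + (-2 * ap4 Y a b a b) *\<^sub>R (c \<odot> c) + (4 * ap4 Y a c b c) *\<^sub>R (a \<odot> b)
    + (-4 * ap4 Y a b b c) *\<^sub>R (a \<odot> c) + (4 * ap4 Y a b a c) *\<^sub>R (b \<odot> c)"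
  have \<alpha>: "\<alpha> \<in> sym_forms"
    unfolding \<alpha>_def by (intro sym_forms_closed sym_tensor_in_sym_forms)
  have "ap2 \<alpha> a a = -2 * ap4 Y b c b c" "ap2 \<alpha> b b = -2 * ap4 Y a c a c" "ap2 \<alpha> c c = -2 * ap4 Y a b a b"
    "ap2 \<alpha> a b = 2 * ap4 Y a c b c" "ap2 \<alpha> a c = -2 * ap4 Y a b b c" "ap2 \<alpha> b c = 2 * ap4 Y a b a c"
    by (simp_all add: \<alpha>_def blinfun.bilinear_simps sym_tensor_apply inner_frame)
  then have "Psi \<alpha> = Y"
    by (intro curvature_eqI Psi_in_curvature_tensors \<alpha> Y) (simp_all add: Psi_coords[OF \<alpha>])
  with \<alpha> show ?thesis
    by (rule that)
qed

end

lemma algebra_isomorphism_Psi: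
  assumes dim: "DIM('v::euclidean_space) = 3"
  shows "algebra_isomorphism (sym_forms :: 'v form2 set) diamond curvature_tensors curv_mult Psi"
proof -
  obtain a b c :: 'v where f: "frame a b c" and Basis: "Basis = {a, b, c}"
    using exists_frame_Basis[OF dim] .
  interpret frame a b c by fact
  have "bij_betw Psi (sym_forms :: 'v form2 set) curvature_tensors"
  proof (rule bij_betw_imageI)
    show "inj_on Psi (sym_forms :: 'v form2 set)"
      by (rule inj_onI) (rule Psi_inj)
    show "Psi ` sym_forms = (curvature_tensors :: 'v form4 set)"
    proof (intro equalityI subsetI)
      fix Y :: "'v form4" assume "Y \<in> curvature_tensors"
      then obtain \<alpha> where "\<alpha> \<in> sym_forms" "Psi \<alpha> = Y"
        by (rule Psi_surj)
      then show "Y \<in> Psi ` sym_forms"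
        by blast
    qed (auto simp: Psi_in_curvature_tensors)
  qed
  then show ?thesis
    using Psi_diamond[OF Basis] by (simp add: algebra_isomorphism_def Psi_add Psi_scale)
qed

text \<open>The hat operator treats its two arguments differently; commutativity is transported from
  \<open>diamond\<close> along \<open>Psi\<close>.\<close>

lemma commutative_algebra_curv_mult:
  assumes dim: "DIM('v::euclidean_space) = 3"
  shows "commutative_algebra (curvature_tensors :: 'v form4 set) curv_mult"
  unfolding commutative_algebra_def
proof (intro conjI ballI allI)
  obtain a b c :: 'v where f: "frame a b c" and Basis: "Basis = {a, b, c}"
    using exists_frame_Basis[OF dim] .
  interpret frame a b c by fact
  fix X Y :: "'v form4" assume X: "X \<in> curvature_tensors" and Y: "Y \<in> curvature_tensors"
  obtain \<alpha> where \<alpha>: "\<alpha> \<in> sym_forms" "Psi \<alpha> = X"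
    using Psi_surj[OF X] .
  obtain \<beta> where \<beta>: "\<beta> \<in> sym_forms" "Psi \<beta> = Y"
    using Psi_surj[OF Y] .
  show "curv_mult X Y = curv_mult Y X"
    using Psi_diamond[OF Basis \<alpha>(1) \<beta>(1)] Psi_diamond[OF Basis \<beta>(1) \<alpha>(1)]
    by (simp only: \<alpha>(2) \<beta>(2) diamond_commute[of \<beta> \<alpha>])
  show "curv_mult X Y \<in> curvature_tensors"
    using Y by (rule curv_mult_in_curvature_tensors)
qed (simp_all add: subspace_curvature_tensors curv_mult_add curv_mult_scale)


theorem corollary8p10:
  assumes dim3: "DIM('v::euclidean_space) = 3"
  shows
    "(commutative_algebra (sym_forms :: 'v form2 set) diamond \<and>
      commutative_algebra (curvature_tensors :: 'v form4 set) curv_mult \<and>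
      algebra_isomorphism (sym_forms :: 'v form2 set) diamond curvature_tensors curv_mult Psi) \<and>
     characterizing_conditions (form_inner :: 'v form2 \<Rightarrow> 'v form2 \<Rightarrow> real) diamond \<and>
     (\<forall>(g :: 'v form2 \<Rightarrow> 'v form2 \<Rightarrow> real) m.
        characterizing_conditions g diamond \<and>
        commutative_algebra sym_forms m \<and> characterizing_conditions g m \<longrightarrow>
        (\<exists>f :: 'v form2 \<Rightarrow> 'v form2.
           algebra_isomorphism sym_forms m sym_forms diamond f)) \<and>
     (\<forall>\<alpha>\<in>(sym_forms :: 'v form2 set). diamond \<alpha> \<alpha> = \<alpha> \<and> \<alpha> \<noteq> 0 \<and> \<alpha> \<noteq> hform \<longrightarrow>
        (\<exists>u :: 'v covector. norm u = 1 \<and> \<alpha> = 2 *\<^sub>R covector_square u)) \<and>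
     (\<forall>\<alpha>\<in>(sym_forms :: 'v form2 set).
        diamond \<alpha> \<alpha> = \<alpha> \<and> \<alpha> \<notin> range (\<lambda>c. c *\<^sub>R hform) \<longrightarrow>
        spectrum_on sym_forms (diamond \<alpha>) = {1, 1/2, -1/2} \<and>
        multiplicity_on sym_forms (diamond \<alpha>) 1 = 1 \<and>
        multiplicity_on sym_forms (diamond \<alpha>) (1/2) = 3 \<and>
        multiplicity_on sym_forms (diamond \<alpha>) (-1/2) = 2) \<and>
     simple_algebra (sym_forms :: 'v form2 set) diamond \<and>
     (\<forall>\<alpha>\<in>(sym_forms :: 'v form2 set). \<forall>\<beta>\<in>sym_forms.
        16/3 * (trace_on sym_forms (diamond (diamond \<alpha> \<beta>))
          - 1/3 * trace_on sym_forms (diamond \<alpha>) * trace_on sym_forms (diamond \<beta>))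
          = form_inner \<alpha> \<beta> \<and>
        form_inner \<alpha> \<beta>
          = 8/5 * (trace_form sym_forms diamond \<alpha> \<beta>
          + 1/9 * trace_on sym_forms (diamond \<alpha>) * trace_on sym_forms (diamond \<beta>))) \<and>
     (\<forall>f :: 'v form2 \<Rightarrow> 'v form2.
        algebra_isomorphism sym_forms diamond sym_forms diamond f \<longleftrightarrow>
        (\<exists>g. orthogonal_transformation g \<and> (\<forall>\<alpha>\<in>sym_forms. f \<alpha> = orth_act g \<alpha>)))"
proof (intro conjI)
  show "commutative_algebra (sym_forms :: 'v form2 set) diamond"
    by (rule commutative_algebra_diamond)
  show "commutative_algebra (curvature_tensors :: 'v form4 set) curv_mult"
    by (rule commutative_algebra_curv_mult[OF dim3])
  show "algebra_isomorphism (sym_forms :: 'v form2 set) diamond curvature_tensors curv_mult Psi"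
    by (rule algebra_isomorphism_Psi[OF dim3])
  show "characterizing_conditions (form_inner :: 'v form2 \<Rightarrow> 'v form2 \<Rightarrow> real) diamond"
    by (rule characterizing_conditions_diamond[OF dim3])
  show "\<forall>(g :: 'v form2 \<Rightarrow> 'v form2 \<Rightarrow> real) m.
      characterizing_conditions g diamond \<and>
      commutative_algebra sym_forms m \<and> characterizing_conditions g m \<longrightarrow>
      (\<exists>f :: 'v form2 \<Rightarrow> 'v form2. algebra_isomorphism sym_forms m sym_forms diamond f)"
  proof (intro allI impI, elim conjE)
    fix g :: "'v form2 \<Rightarrow> 'v form2 \<Rightarrow> real"
      and m :: "'v form2 \<Rightarrow> 'v form2 \<Rightarrow> 'v form2"
    assume "characterizing_conditions g diamond" "commutative_algebra sym_forms m"
      "characterizing_conditions g m"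
    then obtain f :: "'v form2 \<Rightarrow> 'v form2" where "algebra_isomorphism sym_forms m sym_forms diamond f"
      by (rule characterizing_conditions_unique[OF dim3])
    then show "\<exists>f :: 'v form2 \<Rightarrow> 'v form2. algebra_isomorphism sym_forms m sym_forms diamond f"
      by blast
  qed
  show "\<forall>\<alpha>\<in>(sym_forms :: 'v form2 set). diamond \<alpha> \<alpha> = \<alpha> \<and> \<alpha> \<noteq> 0 \<and> \<alpha> \<noteq> hform \<longrightarrow>
      (\<exists>u :: 'v covector. norm u = 1 \<and> \<alpha> = 2 *\<^sub>R covector_square u)"
  proof (intro ballI impI, elim conjE)
    fix \<alpha> :: "'v form2"
    assume "\<alpha> \<in> sym_forms" "diamond \<alpha> \<alpha> = \<alpha>" "\<alpha> \<noteq> 0" "\<alpha> \<noteq> hform"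
    then obtain a b c where "frame a b c" "\<alpha> = 2 *\<^sub>R (a \<odot> a)"
      by (rule diamond_idempotent[OF dim3])
    then have "norm (blinfun_inner_left a) = 1" "\<alpha> = 2 *\<^sub>R covector_square (blinfun_inner_left a)"
      by (simp_all add: norm_blinfun_inner_left norm_eq_1 frame.unit covector_square_eq)
    then show "\<exists>u :: 'v covector. norm u = 1 \<and> \<alpha> = 2 *\<^sub>R covector_square u"
      by blast
  qed
  show "\<forall>\<alpha>\<in>(sym_forms :: 'v form2 set).
      diamond \<alpha> \<alpha> = \<alpha> \<and> \<alpha> \<notin> range (\<lambda>c. c *\<^sub>R hform) \<longrightarrow>
      spectrum_on sym_forms (diamond \<alpha>) = {1, 1/2, -1/2} \<and>
      multiplicity_on sym_forms (diamond \<alpha>) 1 = 1 \<and>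
      multiplicity_on sym_forms (diamond \<alpha>) (1/2) = 3 \<and>
      multiplicity_on sym_forms (diamond \<alpha>) (-1/2) = 2"
  proof (intro ballI impI, elim conjE)
    fix \<alpha> :: "'v form2"
    assume "\<alpha> \<in> sym_forms" "diamond \<alpha> \<alpha> = \<alpha>" "\<alpha> \<notin> range (\<lambda>c. c *\<^sub>R hform)"
    then obtain a b c where f: "frame a b c" and \<alpha>: "\<alpha> = 2 *\<^sub>R (a \<odot> a)"
      by (rule diamond_idempotent_nontrivial[OF dim3])
    show "spectrum_on sym_forms (diamond \<alpha>) = {1, 1/2, -1/2} \<and>
        multiplicity_on sym_forms (diamond \<alpha>) 1 = 1 \<and>
        multiplicity_on sym_forms (diamond \<alpha>) (1/2) = 3 \<and>
        multiplicity_on sym_forms (diamond \<alpha>) (-1/2) = 2"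
      unfolding \<alpha> by (intro conjI frame.diamond_idempotent_spectrum[OF f])
  qed
  show "simple_algebra (sym_forms :: 'v form2 set) diamond"
    by (rule simple_diamond[OF dim3])
  obtain a b c :: 'v where "frame a b c"
    using exists_frame_Basis[OF dim3] .
  then interpret frame a b c .
  \<comment> \<open>Since tr L(\<alpha>) = (3/4) tr \<alpha> and tr(\<alpha> \<diamond> \<beta>) is
    a quarter of the inner product plus the product of traces, the factors 1/3 and 1/9 are those for
    which the products of traces cancel.\<close>
  show "\<forall>\<alpha>\<in>(sym_forms :: 'v form2 set). \<forall>\<beta>\<in>sym_forms.
      16/3 * (trace_on sym_forms (diamond (diamond \<alpha> \<beta>))
        - 1/3 * trace_on sym_forms (diamond \<alpha>) * trace_on sym_forms (diamond \<beta>))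
        = form_inner \<alpha> \<beta> \<and>
      form_inner \<alpha> \<beta>
        = 8/5 * (trace_form sym_forms diamond \<alpha> \<beta>
        + 1/9 * trace_on sym_forms (diamond \<alpha>) * trace_on sym_forms (diamond \<beta>))"
    by (simp add: trace_on_diamond diamond_in_sym_forms form_tr_diamond trace_form_diamond field_simps)
  show "\<forall>f :: 'v form2 \<Rightarrow> 'v form2.
      algebra_isomorphism sym_forms diamond sym_forms diamond f \<longleftrightarrow>
      (\<exists>g. orthogonal_transformation g \<and> (\<forall>\<alpha>\<in>sym_forms. f \<alpha> = orth_act g \<alpha>))"
  proof (intro allI iffI)
    fix f :: "'v form2 \<Rightarrow> 'v form2"
    assume "algebra_isomorphism sym_forms diamond sym_forms diamond f"
    then interpret diamond_automorphism f
      using dim3 by unfold_locales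
    show "\<exists>g. orthogonal_transformation g \<and> (\<forall>\<alpha>\<in>sym_forms. f \<alpha> = orth_act g \<alpha>)"
      using f_eq_orth_act by metis
  next
    fix f :: "'v form2 \<Rightarrow> 'v form2"
    assume "\<exists>g. orthogonal_transformation g \<and> (\<forall>\<alpha>\<in>sym_forms. f \<alpha> = orth_act g \<alpha>)"
    then obtain g where g: "orthogonal_transformation g"
      and eq: "\<And>\<alpha>. \<alpha> \<in> sym_forms \<Longrightarrow> f \<alpha> = orth_act g \<alpha>"
      by blast
    have "bij_betw f sym_forms sym_forms \<longleftrightarrow> bij_betw (orth_act g) sym_forms sym_forms"
      by (rule bij_betw_cong) (rule eq)
    then show "algebra_isomorphism sym_forms diamond sym_forms diamond f"
      using algebra_isomorphism_orth_act[OF dim3 g]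
      by (simp add: algebra_isomorphism_def eq sym_forms_closed diamond_in_sym_forms)
  qed
qed

end
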